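(* Let $\beta\in c_{\rm inc}$ with $\beta(-1)=0$, let $\beta_\infty=\lim_{k\to\infty}(\beta(k)-\beta(k-1))$, and let $c\in\mathbb{C}$. Let $D_{\beta,\tau_\infty}$ and $\tilde D_{\beta,\tau_\infty}$ be the closures in $L^2(S^1)$ of the operators defined on trigonometric polynomials by $$D_{\beta,\tau_\infty}=\beta_\infty\frac1i\frac{d}{dx}+c,\qquad \tilde D_{\beta,\tau_\infty}=e^{ix}\Big(\beta_\infty\frac1i\frac{d}{dx}+c\Big).$$ Then the operators $D_{\beta,\tau_\infty}$, $\tilde D_{\beta,\tau_\infty}$ have compact parametrices if and only if $\beta_\infty\neq0$.
   Context: $\mathbb{N}$ is the set of nonnegative integers; $c_{\rm inc}$ is the set of $\beta:\mathbb{N}\to\mathbb{C}$, extended by $\beta(-1):=0$, such that $\{\beta(k)-\beta(k-1)\}_{k\ge0}$ converges. $S^1=\{e^{ix}:x\in[0,2\pi)\}$. $D_{\beta,\tau_\infty}$ and $\tilde D_{\beta,\tau_\infty}$ are the implementations of the derivations $a\mapsto[\beta(\mathbb{K}-1),a]$ and $a\mapsto[U\beta(\mathbb{K}),a]$ of the Toeplitz algebra (generated by the unilateral shift $U$ on $\ell^2(\mathbb{N})$, with $\beta(\mathbb{K})E_k=\beta(k)E_k$) in the GNS space $L^2(S^1)$ of the state $\tau_\infty(a)=\lim_{k\to\infty}\langle E_k,aE_k\rangle$. A closed densely defined operator $D$ on a Hilbert space has compact parametrices if $(I+D^*D)^{-1/2}$ and $(I+DD^* )^{-1/2}$ are compact.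 The equivalence is asserted for each of the two operators. *)

theory Defs
  imports "HOL-Analysis.Analysis"
begin

section \<open>Complex Hilbert spaces and unbounded operators\<close>

text \<open>
  The complex inner product is linear in its first argument. Norm and topology are those of
  the underlying \<^class>\<open>real_inner\<close> structure, whose inner product is the real part of the
  complex one.
\<close>

class complex_inner = real_inner +
  fixes scaleC :: "complex \<Rightarrow> 'a \<Rightarrow> 'a"
    and cinner :: "'a \<Rightarrow> 'a \<Rightarrow> complex"
  assumes scaleC_add_right: "scaleC a (x + y) = scaleC a x + scaleC a y"
    and scaleC_add_left: "scaleC (a + b) x = scaleC a x + scaleC b x"
    and scaleC_scaleC: "scaleC a (scaleC b x) = scaleC (a * b) x"
    and scaleC_of_real: "scaleC (complex_of_real r) x = scaleR r x"
    and cinner_commute: "cinner x y = cnj (cinner y x)"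
    and cinner_add_left: "cinner (x + y) z = cinner x z + cinner y z"
    and cinner_scaleC_left: "cinner (scaleC a x) y = a * cinner x y"
    and inner_eq_Re_cinner: "inner x y = Re (cinner x y)"

class complex_hilbert = complex_inner + complete_space

text \<open>
  An unbounded operator is represented by its graph, a set of pairs \<open>(x, D x)\<close>; its domain is
  then \<^const>\<open>Domain\<close>, and the closure of an operator is the topological closure of its graph.
\<close>

definition complex_linear_graph :: "('a::complex_inner \<times> 'a) set \<Rightarrow> bool" where
  "complex_linear_graph D \<longleftrightarrow>
     (0, 0) \<in> D \<and>
     (\<forall>x y x' y'. (x, y) \<in> D \<longrightarrow> (x', y') \<in> D \<longrightarrow> (x + x', y + y') \<in> D) \<and>
     (\<forall>a x y. (x, y) \<in> D \<longrightarrow> (scaleC a x, scaleC a y) \<in> D)"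

definition closed_densely_defined :: "('a::complex_inner \<times> 'a) set \<Rightarrow> bool" where
  "closed_densely_defined D \<longleftrightarrow>
     complex_linear_graph D \<and> single_valued D \<and> closed D \<and> closure (Domain D) = UNIV"

definition adjoint_graph :: "('a::complex_inner \<times> 'a) set \<Rightarrow> ('a \<times> 'a) set" where
  "adjoint_graph D = {(y, z). \<forall>(x, w) \<in> D. cinner w y = cinner x z}"

text \<open>
  The operator \<open>I + S T\<close>. The relational product \<open>T O S\<close> applies \<open>T\<close> first.
\<close>

definition id_plus_comp :: "('a::complex_inner \<times> 'a) set \<Rightarrow> ('a \<times> 'a) set \<Rightarrow> ('a \<times> 'a) set" where
  "id_plus_comp S T = {(x, x + y) | x y. (x, y) \<in> T O S}"

definition bounded_complex_linear :: "('a::complex_inner \<Rightarrow> 'a) \<Rightarrow> bool" where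
  "bounded_complex_linear B \<longleftrightarrow> bounded_linear B \<and> (\<forall>a x. B (scaleC a x) = scaleC a (B x))"

definition positive_operator :: "('a::complex_inner \<Rightarrow> 'a) \<Rightarrow> bool" where
  "positive_operator B \<longleftrightarrow> bounded_complex_linear B \<and> (\<forall>x. cinner (B x) x \<in> \<real>\<^sub>\<ge>\<^sub>0)"

text \<open>
  \<open>B\<close> is the inverse square root of \<open>A\<close>: the positive square root of the everywhere defined
  bounded operator \<open>A\<inverse>\<close>. Such a \<open>B\<close> is unique, and for \<open>A = I + D\<^sup>* D\<close> with \<open>D\<close> closed and
  densely defined it exists by von Neumann's theorem.
\<close>

definition inverse_sqrt :: "('a::complex_inner \<times> 'a) set \<Rightarrow> ('a \<Rightarrow> 'a) \<Rightarrow> bool" where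
  "inverse_sqrt A B \<longleftrightarrow> positive_operator B \<and> A\<inverse> = {(x, B (B x)) | x. True}"

definition compact_operator :: "('a::complex_inner \<Rightarrow> 'a) \<Rightarrow> bool" where
  "compact_operator B \<longleftrightarrow> bounded_complex_linear B \<and> compact (closure (B ` cball 0 1))"

definition has_compact_parametrices :: "('a::complex_hilbert \<times> 'a) set \<Rightarrow> bool" where
  "has_compact_parametrices D \<longleftrightarrow>
     closed_densely_defined D \<and>
     (\<exists>B. inverse_sqrt (id_plus_comp (adjoint_graph D) D) B \<and> compact_operator B) \<and>
     (\<exists>B. inverse_sqrt (id_plus_comp D (adjoint_graph D)) B \<and> compact_operator B)"


section \<open>The Hilbert space of square-integrable functions on the circle\<close>

text \<open>
  Normalised arc length on the unit circle, i.e. the image of \<open>dx / 2\<pi>\<close> on \<open>[0, 2\<pi>)\<close> under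
  \<open>x \<mapsto> e\<^sup>i\<^sup>x\<close>. Its \<sigma>-algebra lives on the circle, so neither measurability nor almost-everywhere
  equality depends on values of functions off the circle.
\<close>

definition circle_measure :: "complex measure" where
  "circle_measure = distr (uniform_measure lborel {0..<2 * pi}) (restrict_space borel (sphere 0 1)) cis"

lemma space_circle_measure [simp]: "space circle_measure = sphere 0 1"
  by (simp add: circle_measure_def space_restrict_space)

lemma sets_circle_measure [measurable_cong]:
  "sets circle_measure = sets (restrict_space borel (sphere 0 1))"
  by (simp add: circle_measure_def)

lemma cis_measurable_circle:
  "cis \<in> measurable (uniform_measure lborel {0..<2 * pi}) (restrict_space borel (sphere 0 1))"
proof (rule measurable_restrict_space2)
  have "cis \<in> borel_measurable borel"
    by (intro borel_measurable_continuous_onI continuous_intros)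
  then show "cis \<in> borel_measurable (uniform_measure lborel {0..<2 * pi})"
    by (simp add: measurable_def)
qed simp

lemma finite_measure_circle: "finite_measure circle_measure"
proof -
  have "emeasure (uniform_measure lborel {0..<2 * pi}) UNIV \<le> 1"
    by (subst emeasure_uniform_measure) (auto simp: ennreal_divide_self divide_ennreal)
  then have "finite_measure (uniform_measure lborel {0..<2 * pi})"
    by (intro finite_measureI) (auto simp: top_unique)
  then show ?thesis
    unfolding circle_measure_def
    by (rule finite_measure.finite_measure_distr[OF _ cis_measurable_circle])
qed

lemma emeasure_circle_space: "emeasure circle_measure (space circle_measure) = 1"
proof -
  have "emeasure circle_measure (sphere 0 1) =
      emeasure (uniform_measure lborel {0..<2 * pi}) (cis -` sphere 0 1 \<inter> UNIV)"
    unfolding circle_measure_def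
    by (subst emeasure_distr[OF cis_measurable_circle]) (auto simp: sets_restrict_space)
  also have "cis -` sphere 0 1 \<inter> UNIV = (UNIV :: real set)"
    by auto
  also have "emeasure (uniform_measure lborel {0..<2 * pi}) UNIV = 1"
    by (subst emeasure_uniform_measure) (auto simp: ennreal_divide_self divide_ennreal)
  finally show ?thesis by simp
qed

definition square_integrable :: "(complex \<Rightarrow> complex) \<Rightarrow> bool" where
  "square_integrable f \<longleftrightarrow>
     f \<in> borel_measurable circle_measure \<and> integrable circle_measure (\<lambda>z. (norm (f z))\<^sup>2)"

lemma square_integrable_measurable [measurable_dest]:
  "square_integrable f \<Longrightarrow> f \<in> borel_measurable circle_measure"
  by (simp add: square_integrable_def)

lemma square_integrable_zero: "square_integrable (\<lambda>z. 0)"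
  by (simp add: square_integrable_def)

lemma square_integrable_add:
  assumes "square_integrable f" "square_integrable g"
  shows "square_integrable (\<lambda>z. f z + g z)"
  unfolding square_integrable_def
proof
  note [measurable] = assms[THEN square_integrable_measurable]
  show "(\<lambda>z. f z + g z) \<in> borel_measurable circle_measure" by measurable
  have le: "(norm (f z + g z))\<^sup>2 \<le> 2 * (norm (f z))\<^sup>2 + 2 * (norm (g z))\<^sup>2" for z
  proof -
    have "(norm (f z + g z))\<^sup>2 \<le> (norm (f z) + norm (g z))\<^sup>2"
      by (intro power_mono norm_triangle_ineq) simp
    also have "\<dots> \<le> 2 * (norm (f z))\<^sup>2 + 2 * (norm (g z))\<^sup>2"
      using sum_squares_bound[of "norm (f z)" "norm (g z)"] by (simp add: power2_sum)
    finally show ?thesis .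
  qed
  show "integrable circle_measure (\<lambda>z. (norm (f z + g z))\<^sup>2)"
    by (rule Bochner_Integration.integrable_bound
        [where f = "\<lambda>z. 2 * (norm (f z))\<^sup>2 + 2 * (norm (g z))\<^sup>2"])
      (use assms le in \<open>auto simp: square_integrable_def\<close>)
qed

lemma square_integrable_mult:
  "square_integrable f \<Longrightarrow> square_integrable (\<lambda>z. a * f z)"
  by (auto simp: square_integrable_def norm_mult power_mult_distrib)

lemma square_integrable_scaleR:
  "square_integrable f \<Longrightarrow> square_integrable (\<lambda>z. r *\<^sub>R f z)"
  using square_integrable_mult[of f "complex_of_real r"] by (simp add: scaleR_conv_of_real)

lemma square_integrable_uminus:
  "square_integrable f \<Longrightarrow> square_integrable (\<lambda>z. - f z)"
  using square_integrable_mult[of f "-1"] by simp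

lemma square_integrable_diff:
  "square_integrable f \<Longrightarrow> square_integrable g \<Longrightarrow> square_integrable (\<lambda>z. f z - g z)"
  using square_integrable_add[OF _ square_integrable_uminus] by simp

lemma integrable_mult_cnj:
  assumes "square_integrable f" "square_integrable g"
  shows "integrable circle_measure (\<lambda>z. f z * cnj (g z))"
proof -
  note [measurable] = assms[THEN square_integrable_measurable]
  have le: "norm (f z * cnj (g z)) \<le> (norm (f z))\<^sup>2 + (norm (g z))\<^sup>2" for z
    using sum_squares_bound[of "norm (f z)" "norm (g z)"]
      mult_nonneg_nonneg[OF norm_ge_zero[of "f z"] norm_ge_zero[of "g z"]]
    unfolding norm_mult complex_mod_cnj by linarith
  have [measurable]: "(\<lambda>z. cnj (g z)) \<in> borel_measurable circle_measure"
    by (rule borel_measurable_continuous_on[OF continuous_on_cnj[OF continuous_on_id]]) measurable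
  show ?thesis
    by (rule Bochner_Integration.integrable_bound
        [where f = "\<lambda>z. (norm (f z))\<^sup>2 + (norm (g z))\<^sup>2"])
      (use assms le in \<open>auto simp: square_integrable_def\<close>)
qed

definition L2_rel :: "(complex \<Rightarrow> complex) \<Rightarrow> (complex \<Rightarrow> complex) \<Rightarrow> bool" where
  "L2_rel f g \<longleftrightarrow> square_integrable f \<and> square_integrable g \<and> (AE z in circle_measure. f z = g z)"

quotient_type L2_circle = "complex \<Rightarrow> complex" / partial: L2_rel
  morphisms rep_L2 L2_class
proof (rule part_equivpI)
  show "\<exists>f. L2_rel f f"
    using square_integrable_zero by (auto simp: L2_rel_def)
  show "symp L2_rel"
    by (auto simp: symp_def L2_rel_def)
  show "transp L2_rel"
    by (rule transpI) (auto simp: L2_rel_def)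
qed

instantiation L2_circle :: real_inner
begin

lift_definition zero_L2_circle :: L2_circle is "\<lambda>z. 0"
  by (simp add: L2_rel_def square_integrable_zero)

lift_definition plus_L2_circle :: "L2_circle \<Rightarrow> L2_circle \<Rightarrow> L2_circle" is "\<lambda>f g z. f z + g z"
  by (auto simp: L2_rel_def square_integrable_add)

lift_definition uminus_L2_circle :: "L2_circle \<Rightarrow> L2_circle" is "\<lambda>f z. - f z"
  by (auto simp: L2_rel_def square_integrable_uminus)

lift_definition minus_L2_circle :: "L2_circle \<Rightarrow> L2_circle \<Rightarrow> L2_circle" is "\<lambda>f g z. f z - g z"
  by (auto simp: L2_rel_def square_integrable_diff)

lift_definition scaleR_L2_circle :: "real \<Rightarrow> L2_circle \<Rightarrow> L2_circle" is "\<lambda>r f z. r *\<^sub>R f z"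
  by (auto simp: L2_rel_def square_integrable_scaleR)

lift_definition inner_L2_circle :: "L2_circle \<Rightarrow> L2_circle \<Rightarrow> real"
  is "\<lambda>f g. Re (\<integral>z. f z * cnj (g z) \<partial>circle_measure)"
proof -
  fix f f' g g' assume *: "L2_rel f f'" "L2_rel g g'"
  have "(\<integral>z. f z * cnj (g z) \<partial>circle_measure) = (\<integral>z. f' z * cnj (g' z) \<partial>circle_measure)"
    by (rule integral_cong_AE)
      (use * in \<open>auto simp: L2_rel_def intro!: borel_measurable_integrable integrable_mult_cnj\<close>)
  then show "Re (\<integral>z. f z * cnj (g z) \<partial>circle_measure) = Re (\<integral>z. f' z * cnj (g' z) \<partial>circle_measure)"
    by simp
qed

definition norm_L2_circle :: "L2_circle \<Rightarrow> real" where
  "norm_L2_circle x = sqrt (inner x x)"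

definition dist_L2_circle :: "L2_circle \<Rightarrow> L2_circle \<Rightarrow> real" where
  "dist_L2_circle x y = norm (x - y)"

definition sgn_L2_circle :: "L2_circle \<Rightarrow> L2_circle" where
  "sgn_L2_circle x = inverse (norm x) *\<^sub>R x"

definition uniformity_L2_circle :: "(L2_circle \<times> L2_circle) filter" where
  "uniformity_L2_circle = (INF e\<in>{0 <..}. principal {(x, y). dist x y < e})"

definition open_L2_circle :: "L2_circle set \<Rightarrow> bool" where
  "open_L2_circle S = (\<forall>x\<in>S. \<forall>\<^sub>F (x', y) in uniformity. x' = x \<longrightarrow> y \<in> S)"

instance
proof
  fix x y z :: L2_circle and r s :: real
  show "x + y + z = x + (y + z)"
    by transfer (auto simp: L2_rel_def add.assoc intro!: square_integrable_add)
  show "x + y = y + x"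
    by transfer (auto simp: L2_rel_def add.commute intro!: square_integrable_add)
  show "0 + x = x"
    by transfer (auto simp: L2_rel_def)
  show "- x + x = 0"
    by transfer (auto simp: L2_rel_def square_integrable_zero)
  show "x - y = x + - y"
    by transfer (auto simp: L2_rel_def intro!: square_integrable_diff)
  show "r *\<^sub>R (x + y) = r *\<^sub>R x + r *\<^sub>R y"
    by transfer (auto simp: L2_rel_def scaleR_add_right
        intro!: square_integrable_add square_integrable_scaleR)
  show "(r + s) *\<^sub>R x = r *\<^sub>R x + s *\<^sub>R x"
    by transfer (auto simp: L2_rel_def scaleR_add_left
        intro!: square_integrable_add square_integrable_scaleR)
  show "r *\<^sub>R s *\<^sub>R x = (r * s) *\<^sub>R x"
    by transfer (auto simp: L2_rel_def intro!: square_integrable_scaleR)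
  show "1 *\<^sub>R x = x"
    by transfer (auto simp: L2_rel_def)
  show "sgn x = inverse (norm x) *\<^sub>R x"
    by (rule sgn_L2_circle_def)
  show "dist x y = norm (x - y)"
    by (rule dist_L2_circle_def)
  show "(uniformity :: (L2_circle \<times> L2_circle) filter)
      = (INF e\<in>{0 <..}. principal {(x, y). dist x y < e})"
    by (rule uniformity_L2_circle_def)
  show "open U = (\<forall>x\<in>U. \<forall>\<^sub>F (x', y) in uniformity. x' = x \<longrightarrow> y \<in> U)" for U :: "L2_circle set"
    by (rule open_L2_circle_def)
  show "norm x = sqrt (inner x x)"
    by (rule norm_L2_circle_def)
  show "inner x y = inner y x"
  proof transfer
    fix f g assume "L2_rel f f" "L2_rel g g"
    have "(\<integral>z. g z * cnj (f z) \<partial>circle_measure) = (\<integral>z. cnj (f z * cnj (g z)) \<partial>circle_measure)"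
      by (simp add: mult.commute)
    also have "\<dots> = cnj (\<integral>z. f z * cnj (g z) \<partial>circle_measure)"
      by (rule Bochner_Integration.integral_cnj)
    finally show "Re (\<integral>z. f z * cnj (g z) \<partial>circle_measure) = Re (\<integral>z. g z * cnj (f z) \<partial>circle_measure)"
      by simp
  qed
  show "inner (x + y) z = inner x z + inner y z"
    by transfer (auto simp: L2_rel_def distrib_right integrable_mult_cnj)
  show "inner (r *\<^sub>R x) y = r * inner x y"
    by transfer (auto simp: L2_rel_def)
  have sq: "f w * cnj (f w) = complex_of_real ((norm (f w))\<^sup>2)" for f :: "complex \<Rightarrow> complex" and w
    by (rule complex_norm_square[symmetric])
  show "0 \<le> inner x x"
    by transfer (auto simp: sq simp del: of_real_power)
  show "(inner x x = 0) = (x = 0)"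
  proof transfer
    fix f assume f: "L2_rel f f"
    then have "((\<integral>z. (norm (f z))\<^sup>2 \<partial>circle_measure) = 0)
        = (AE z in circle_measure. (norm (f z))\<^sup>2 = 0)"
      by (intro integral_nonneg_eq_0_iff_AE) (auto simp: L2_rel_def square_integrable_def)
    then show "(Re (\<integral>z. f z * cnj (f z) \<partial>circle_measure) = 0) = L2_rel f (\<lambda>z. 0)"
      using f by (simp add: sq L2_rel_def square_integrable_zero del: of_real_power)
  qed
qed

end

instantiation L2_circle :: complex_inner
begin

lift_definition scaleC_L2_circle :: "complex \<Rightarrow> L2_circle \<Rightarrow> L2_circle" is "\<lambda>a f z. a * f z"
  by (auto simp: L2_rel_def square_integrable_mult)

lift_definition cinner_L2_circle :: "L2_circle \<Rightarrow> L2_circle \<Rightarrow> complex"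
  is "\<lambda>f g. \<integral>z. f z * cnj (g z) \<partial>circle_measure"
  by (rule integral_cong_AE)
    (auto simp: L2_rel_def intro!: borel_measurable_integrable integrable_mult_cnj)

instance
proof
  fix x y z :: L2_circle and a b :: complex and r :: real
  show "scaleC a (x + y) = scaleC a x + scaleC a y"
    by transfer (auto simp: L2_rel_def distrib_left
        intro!: square_integrable_add square_integrable_mult)
  show "scaleC (a + b) x = scaleC a x + scaleC b x"
    by transfer (auto simp: L2_rel_def distrib_right
        intro!: square_integrable_add square_integrable_mult)
  show "scaleC a (scaleC b x) = scaleC (a * b) x"
    by transfer (auto simp: L2_rel_def mult.assoc intro!: square_integrable_mult)
  show "scaleC (complex_of_real r) x = r *\<^sub>R x"
    by transfer (auto simp: L2_rel_def scaleR_conv_of_real intro!: square_integrable_mult)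
  show "cinner x y = cnj (cinner y x)"
  proof transfer
    fix f g assume "L2_rel f f" "L2_rel g g"
    have "(\<integral>z. f z * cnj (g z) \<partial>circle_measure) = (\<integral>z. cnj (g z * cnj (f z)) \<partial>circle_measure)"
      by (simp add: mult.commute)
    then show "(\<integral>z. f z * cnj (g z) \<partial>circle_measure) = cnj (\<integral>z. g z * cnj (f z) \<partial>circle_measure)"
      by (simp only: Bochner_Integration.integral_cnj)
  qed
  show "cinner (x + y) z = cinner x z + cinner y z"
    by transfer (auto simp: L2_rel_def distrib_right integrable_mult_cnj)
  show "cinner (scaleC a x) y = a * cinner x y"
    by transfer (auto simp: L2_rel_def mult.assoc)
  show "inner x y = Re (cinner x y)"
    by transfer simp
qed

end

lemma norm_L2_class:
  assumes "square_integrable f"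
  shows "(norm (L2_class f))\<^sup>2 = (\<integral>z. (norm (f z))\<^sup>2 \<partial>circle_measure)"
proof -
  have "inner (L2_class f) (L2_class f) = Re (\<integral>z. f z * cnj (f z) \<partial>circle_measure)"
    using assms by (simp add: inner_L2_circle.abs_eq L2_rel_def)
  also have "\<dots> = (\<integral>z. (norm (f z))\<^sup>2 \<partial>circle_measure)"
    by (simp add: complex_norm_square[symmetric] del: of_real_power)
  finally show ?thesis
    by (simp add: power2_norm_eq_inner)
qed

lemma L2_class_diff:
  "square_integrable f \<Longrightarrow> square_integrable g \<Longrightarrow>
    L2_class f - L2_class g = L2_class (\<lambda>z. f z - g z)"
  by (simp add: minus_L2_circle.abs_eq L2_rel_def)

lemma rep_L2_square_integrable: "square_integrable (rep_L2 x)"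
  using Quotient_rep_reflp[OF Quotient_L2_circle, of x] by (simp add: L2_rel_def)

lemma L2_class_rep [simp]: "L2_class (rep_L2 x) = x"
  by (rule Quotient_abs_rep[OF Quotient_L2_circle])

lemma rep_L2_square_norm_le:
  assumes f: "square_integrable f" and g: "square_integrable g"
    and le: "norm (L2_class f - L2_class g) \<le> e"
  shows "(\<integral>\<^sup>+z. ennreal ((norm (f z - g z))\<^sup>2) \<partial>circle_measure) \<le> ennreal (e\<^sup>2)"
proof -
  have h: "square_integrable (\<lambda>z. f z - g z)"
    by (intro square_integrable_diff f g)
  then have "(\<integral>\<^sup>+z. ennreal ((norm (f z - g z))\<^sup>2) \<partial>circle_measure)
      = ennreal (\<integral>z. (norm (f z - g z))\<^sup>2 \<partial>circle_measure)"
    by (intro nn_integral_eq_integral) (auto simp: square_integrable_def)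
  also have "\<dots> = ennreal ((norm (L2_class f - L2_class g))\<^sup>2)"
    using norm_L2_class[OF h] by (simp add: L2_class_diff f g)
  also have "\<dots> \<le> ennreal (e\<^sup>2)"
    using le by (intro ennreal_leI power_mono) auto
  finally show ?thesis .
qed

lemma L2_circle_Cauchy_convergent:
  fixes X :: "nat \<Rightarrow> L2_circle"
  assumes X: "Cauchy X"
  shows "convergent X"
proof -
  have "\<exists>M. \<forall>m\<ge>M. \<forall>k\<ge>M. norm (X m - X k) < (1/2)^n" for n
    using CauchyD[OF X, of "(1/2)^n"] by simp
  then obtain M where M: "\<And>n m k. m \<ge> M n \<Longrightarrow> k \<ge> M n \<Longrightarrow> norm (X m - X k) < (1/2)^n"
    by metis
  define r where "r n = n + (\<Sum>i\<le>n. M i)" for n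
  have r: "strict_mono r"
    by (rule strict_monoI_Suc) (simp add: r_def)
  have rM: "r m \<ge> M n" if "m \<ge> n" for m n
  proof -
    have "M n \<le> (\<Sum>i\<le>m. M i)"
      using that by (intro member_le_sum) auto
    then show ?thesis by (simp add: r_def)
  qed
  define g where "g n = rep_L2 (X (r n))" for n
  have g: "square_integrable (g n)" for n
    by (simp add: g_def rep_L2_square_integrable)
  note [measurable] = square_integrable_measurable[OF g]
  have class_g: "L2_class (g n) = X (r n)" for n
    by (simp add: g_def)
  have dist: "(\<integral>\<^sup>+z. ennreal ((norm (g m z - g n z))\<^sup>2) \<partial>circle_measure) \<le> ennreal (((1/2)^n)\<^sup>2)"
    if "m \<ge> n" for m n
    using M[OF rM[OF that] rM[OF order_refl]]
    by (intro rep_L2_square_norm_le g) (simp add: class_g less_imp_le)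

  have L1: "(\<integral>\<^sup>+z. ennreal (norm (g (Suc n) z - g n z)) \<partial>circle_measure) \<le> ennreal ((1/2)^n)" for n
  proof -
    have pt: "ennreal (norm w) \<le> ennreal ((1/2)^n / 2) + ennreal (2^n / 2) * ennreal ((norm w)\<^sup>2)"
      for w :: complex
    proof -
      have "0 \<le> (2^n * norm w - 1)\<^sup>2" by simp
      then have "norm w \<le> (1/2)^n / 2 + 2^n / 2 * (norm w)\<^sup>2"
        by (simp add: field_simps power_divide power2_eq_square)
      then show ?thesis
        by (simp add: ennreal_mult[symmetric] ennreal_plus[symmetric] ennreal_leI del: ennreal_plus)
    qed
    have "(\<integral>\<^sup>+z. ennreal (norm (g (Suc n) z - g n z)) \<partial>circle_measure)
        \<le> (\<integral>\<^sup>+z. ennreal ((1/2)^n / 2)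
              + ennreal (2^n / 2) * ennreal ((norm (g (Suc n) z - g n z))\<^sup>2) \<partial>circle_measure)"
      by (intro nn_integral_mono pt)
    also have "\<dots> = ennreal ((1/2)^n / 2)
        + ennreal (2^n / 2) * (\<integral>\<^sup>+z. ennreal ((norm (g (Suc n) z - g n z))\<^sup>2) \<partial>circle_measure)"
      using emeasure_circle_space by (subst nn_integral_add) (auto simp: nn_integral_cmult)
    also have "\<dots> \<le> ennreal ((1/2)^n / 2) + ennreal (2^n / 2) * ennreal (((1/2)^n)\<^sup>2)"
      by (intro add_left_mono mult_left_mono dist) auto
    also have "\<dots> = ennreal ((1/2)^n / 2 + 2^n / 2 * ((1/2)^n)\<^sup>2)"
      by (subst ennreal_mult[symmetric]) (auto simp flip: ennreal_plus)
    also have "(1/2)^n / 2 + 2^n / 2 * ((1/2)^n)\<^sup>2 = (1/2 :: real)^n"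
      by (simp add: field_simps power_divide power2_eq_square)
    finally show ?thesis .
  qed

  have "(\<integral>\<^sup>+z. (\<Sum>n. ennreal (norm (g (Suc n) z - g n z))) \<partial>circle_measure)
      = (\<Sum>n. \<integral>\<^sup>+z. ennreal (norm (g (Suc n) z - g n z)) \<partial>circle_measure)"
    by (rule nn_integral_suminf) measurable
  also have "\<dots> \<le> (\<Sum>n. ennreal ((1/2)^n))"
    by (intro suminf_le L1) auto
  also have "\<dots> = ennreal (\<Sum>n. (1/2)^n)"
    by (intro suminf_ennreal2) (auto intro: summable_geometric)
  also have "\<dots> < \<infinity>" by simp
  finally have "AE z in circle_measure. (\<Sum>n. ennreal (norm (g (Suc n) z - g n z))) \<noteq> \<infinity>"
    by (intro nn_integral_PInf_AE) auto
  then have lim: "AE z in circle_measure. (\<lambda>n. g n z) \<longlonglongrightarrow> lim (\<lambda>n. g n z)"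
  proof eventually_elim
    case (elim z)
    then have "summable (\<lambda>n. norm (g (Suc n) z - g n z))"
      by (intro summable_suminf_not_top) auto
    then have "summable (\<lambda>n. g (Suc n) z - g n z)"
      by (rule summable_norm_cancel)
    then have "convergent (\<lambda>n. \<Sum>i<n. g (Suc i) z - g i z)"
      by (simp add: summable_iff_convergent)
    then have "convergent (\<lambda>n. g n z - g 0 z)"
      by (simp add: sum_lessThan_telescope[of "\<lambda>n. g n z"])
    then have "convergent (\<lambda>n. g n z)"
      by (simp add: convergent_diff_const_right_iff)
    then show ?case by (simp add: convergent_LIMSEQ_iff)
  qed

  define G where "G z = lim (\<lambda>n. g n z)" for z
  have [measurable]: "G \<in> borel_measurable circle_measure"
    unfolding G_def by measurable
  have Gdist: "(\<integral>\<^sup>+z. ennreal ((norm (G z - g n z))\<^sup>2) \<partial>circle_measure) \<le> ennreal (((1/2)^n)\<^sup>2)" for n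
  proof -
    have "(\<integral>\<^sup>+z. ennreal ((norm (G z - g n z))\<^sup>2) \<partial>circle_measure)
        = (\<integral>\<^sup>+z. liminf (\<lambda>m. ennreal ((norm (g m z - g n z))\<^sup>2)) \<partial>circle_measure)"
    proof (rule nn_integral_cong_AE, use lim in eventually_elim)
      case (elim z)
      then have "(\<lambda>m. ennreal ((norm (g m z - g n z))\<^sup>2)) \<longlonglongrightarrow> ennreal ((norm (G z - g n z))\<^sup>2)"
        unfolding G_def by (intro tendsto_intros)
      then show ?case
        by (intro lim_imp_Liminf[symmetric]) auto
    qed
    also have "\<dots> \<le> liminf (\<lambda>m. \<integral>\<^sup>+z. ennreal ((norm (g m z - g n z))\<^sup>2) \<partial>circle_measure)"
      by (rule nn_integral_liminf) measurable
    also have "\<dots> \<le> liminf (\<lambda>m. ennreal (((1/2)^n)\<^sup>2))"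
      by (intro Liminf_mono eventually_sequentiallyI[of n] dist)
    also have "\<dots> = ennreal (((1/2)^n)\<^sup>2)"
      by (intro Liminf_const) simp
    finally show ?thesis .
  qed
  have diff: "square_integrable (\<lambda>z. G z - g n z)" for n
    unfolding square_integrable_def
  proof
    show "integrable circle_measure (\<lambda>z. (norm (G z - g n z))\<^sup>2)"
      using Gdist[of n] by (intro integrableI_bounded) (auto intro: le_less_trans)
  qed measurable
  have G: "square_integrable G"
    using square_integrable_add[OF diff[of 0] g[of 0]] by simp
  have "norm (X (r n) - L2_class G) \<le> (1/2)^n" for n
  proof -
    have "ennreal ((norm (L2_class G - X (r n)))\<^sup>2)
        = (\<integral>\<^sup>+z. ennreal ((norm (G z - g n z))\<^sup>2) \<partial>circle_measure)"
      using diff[of n] norm_L2_class[OF diff[of n]]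
      by (subst nn_integral_eq_integral)
        (auto simp: square_integrable_def class_g[symmetric] L2_class_diff[OF G g])
    also note Gdist[of n]
    finally have "(norm (L2_class G - X (r n)))\<^sup>2 \<le> ((1/2)^n)\<^sup>2"
      by (simp add: ennreal_le_iff)
    then have "norm (L2_class G - X (r n)) \<le> (1/2)^n"
      by (rule power2_le_imp_le) simp
    then show ?thesis by (simp add: norm_minus_commute)
  qed
  then have "(\<lambda>n. X (r n) - L2_class G) \<longlonglongrightarrow> 0"
    by (intro Lim_null_comparison[OF always_eventually LIMSEQ_realpow_zero[of "1/2"]]) auto
  then have "(X \<circ> r) \<longlonglongrightarrow> L2_class G"
    by (simp add: LIM_zero_iff o_def)
  then have "X \<longlonglongrightarrow> L2_class G"
    by (rule Cauchy_converges_subseq[OF X r])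
  then show ?thesis by (rule convergentI)
qed

instance L2_circle :: complex_hilbert
  by standard (rule L2_circle_Cauchy_convergent)


section \<open>The first-order operators on the circle\<close>

text \<open>
  Functions on \<open>S\<^sup>1\<close> are functions of the complex variable \<open>z = e\<^sup>i\<^sup>x\<close>, so that \<open>z\<^sup>n = e\<^sup>i\<^sup>n\<^sup>x\<close>;
  their values off the circle are immaterial.
\<close>

definition trig_poly :: "(complex \<Rightarrow> complex) \<Rightarrow> bool" where
  "trig_poly f \<longleftrightarrow>
     (\<exists>(N::nat) (a :: int \<Rightarrow> complex). \<forall>z. norm z = 1 \<longrightarrow> f z = (\<Sum>n = - int N..int N. a n * z powi n))"

text \<open>
  The derivative \<open>d/dx\<close> of \<open>x \<mapsto> f (e\<^sup>i\<^sup>x)\<close> at the point \<open>z = e\<^sup>i\<^sup>x\<close>.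
\<close>

definition angular_deriv :: "(complex \<Rightarrow> complex) \<Rightarrow> complex \<Rightarrow> complex" where
  "angular_deriv f z = vector_derivative (\<lambda>t. f (z * cis t)) (at 0)"

definition first_order_op :: "complex \<Rightarrow> complex \<Rightarrow> (complex \<Rightarrow> complex) \<Rightarrow> complex \<Rightarrow> complex" where
  "first_order_op b c f z = b * (1 / \<i>) * angular_deriv f z + c * f z"

lemma angular_deriv_cis: "angular_deriv f (cis x) = vector_derivative (\<lambda>s. f (cis s)) (at x)"
proof -
  have "((\<lambda>t. f (cis (x + t))) has_vector_derivative D) (at 0) \<longleftrightarrow>
      ((\<lambda>s. f (cis s)) has_vector_derivative D) (at x)" for D
    by (simp add: has_vector_derivative_def has_derivative_at)
  then show ?thesis
    by (simp add: angular_deriv_def vector_derivative_def cis_mult)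
qed

lemma angular_deriv_trig_poly:
  assumes f: "\<And>z. norm z = 1 \<Longrightarrow> f z = (\<Sum>n = - int N..int N. a n * z powi n)" and z: "norm z = 1"
  shows "angular_deriv f z = (\<Sum>n = - int N..int N. \<i> * of_int n * a n * z powi n)"
proof -
  have cis_powi: "cis t powi n = exp (\<i> * of_int n * of_real t)" for t n
    by (simp add: cis_power_int) (simp add: cis_conv_exp mult_ac)
  have "f (z * cis t) = (\<Sum>n = - int N..int N. a n * z powi n * exp (\<i> * of_int n * of_real t))" for t
    using z by (subst f) (simp_all add: norm_mult power_int_mult_distrib cis_powi mult.assoc)
  moreover have "((\<lambda>t. \<Sum>n = - int N..int N. a n * z powi n * exp (\<i> * of_int n * of_real t))
      has_vector_derivative (\<Sum>n = - int N..int N. a n * z powi n * (\<i> * of_int n * exp (\<i> * of_int n * of_real 0)))) (at 0)"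
    by (intro has_vector_derivative_sum) (rule has_vector_derivative_real_field, auto intro!: derivative_eq_intros)
  ultimately show ?thesis
    by (simp add: angular_deriv_def vector_derivative_at mult_ac)
qed

lemma trig_poly_first_order_op:
  assumes "trig_poly f"
  shows "trig_poly (first_order_op b c f)" "trig_poly (\<lambda>z. z * first_order_op b c f z)"
proof -
  obtain N a where f: "\<And>z. norm z = 1 \<Longrightarrow> f z = (\<Sum>n = - int N..int N. a n * z powi n)"
    using assms by (auto simp: trig_poly_def)
  define d where "d n = (b * of_int n + c) * a n" for n :: int
  have d: "first_order_op b c f z = (\<Sum>n = - int N..int N. d n * z powi n)" if "norm z = 1" for z
  proof -
    have "angular_deriv f z = (\<Sum>n = - int N..int N. \<i> * of_int n * a n * z powi n)"
      using f that by (rule angular_deriv_trig_poly)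
    then show ?thesis
      unfolding first_order_op_def f[OF that] d_def
      by (simp add: sum_distrib_left sum.distrib[symmetric] algebra_simps)
  qed
  then show "trig_poly (first_order_op b c f)"
    unfolding trig_poly_def by blast
  define e where "e n = (if n - 1 \<in> {- int N..int N} then d (n - 1) else 0)" for n
  have "z * first_order_op b c f z = (\<Sum>n = - int (Suc N)..int (Suc N). e n * z powi n)"
    if z: "norm z = 1" for z
  proof -
    have "(\<Sum>n = - int (Suc N)..int (Suc N). e n * z powi n)
        = (\<Sum>n = - int N + 1..int N + 1. e n * z powi n)"
      by (intro sum.mono_neutral_right) (auto simp: e_def)
    also have "\<dots> = (\<Sum>n = - int N..int N. e (n + 1) * z powi (n + 1))"
      by (intro sum.reindex_bij_witness[where i = "\<lambda>n. n + 1" and j = "\<lambda>n. n - 1"]) auto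
    also have "\<dots> = (\<Sum>n = - int N..int N. z * (d n * z powi n))"
    proof (intro sum.cong refl)
      fix n assume "n \<in> {- int N..int N}"
      moreover have "z powi (n + 1) = z * z powi n"
        using z by (subst power_int_add) auto
      ultimately show "e (n + 1) * z powi (n + 1) = z * (d n * z powi n)"
        by (simp add: e_def)
    qed
    finally show ?thesis
      by (simp add: d[OF z] sum_distrib_left)
  qed
  then show "trig_poly (\<lambda>z. z * first_order_op b c f z)"
    unfolding trig_poly_def by blast
qed

lemma trig_poly_square_integrable:
  assumes "trig_poly f"
  shows "square_integrable f"
proof -
  obtain N a where f: "\<And>z. norm z = 1 \<Longrightarrow> f z = (\<Sum>n = - int N..int N. a n * z powi n)"
    using assms by (auto simp: trig_poly_def)
  have cont: "continuous_on (sphere 0 1) f"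
  proof (rule continuous_on_eq)
    show "continuous_on (sphere 0 1) (\<lambda>z. \<Sum>n = - int N..int N. a n * z powi n)"
      by (intro continuous_intros) auto
  qed (simp add: f)
  then have "f \<in> borel_measurable (restrict_space borel (sphere 0 1))"
    by (rule borel_measurable_continuous_on_restrict)
  then have [measurable]: "f \<in> borel_measurable circle_measure"
    by (simp add: measurable_cong_sets[OF sets_circle_measure refl])
  have "compact (f ` sphere 0 1)"
    by (intro compact_continuous_image cont) simp
  then obtain C where C: "\<And>z. z \<in> sphere 0 1 \<Longrightarrow> norm (f z) \<le> C"
    using compact_imp_bounded bounded_iff by (metis imageI)
  have "integrable circle_measure (\<lambda>z. (norm (f z))\<^sup>2)"
    by (rule finite_measure.integrable_const_bound[OF finite_measure_circle, of _ "C\<^sup>2"])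
      (auto intro!: AE_I2 power_mono C)
  then show ?thesis by (simp add: square_integrable_def)
qed

text \<open>
  The space \<open>c\<^sub>i\<^sub>n\<^sub>c\<close>, with the convention \<open>\<beta>(-1) = 0\<close> built into the increment at \<open>0\<close>.
\<close>

definition increment :: "(nat \<Rightarrow> complex) \<Rightarrow> nat \<Rightarrow> complex" where
  "increment \<beta> k = \<beta> k - (if k = 0 then 0 else \<beta> (k - 1))"

definition c_inc :: "(nat \<Rightarrow> complex) set" where
  "c_inc = {\<beta>. convergent (increment \<beta>)}"

definition increment_limit :: "(nat \<Rightarrow> complex) \<Rightarrow> complex" where
  "increment_limit \<beta> = lim (increment \<beta>)"

definition D_tau_inf :: "(nat \<Rightarrow> complex) \<Rightarrow> complex \<Rightarrow> (L2_circle \<times> L2_circle) set" where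
  "D_tau_inf \<beta> c = closure
     {(L2_class f, L2_class (first_order_op (increment_limit \<beta>) c f)) | f. trig_poly f}"

definition D_tilde_tau_inf :: "(nat \<Rightarrow> complex) \<Rightarrow> complex \<Rightarrow> (L2_circle \<times> L2_circle) set" where
  "D_tilde_tau_inf \<beta> c = closure
     {(L2_class f, L2_class (\<lambda>z. z * first_order_op (increment_limit \<beta>) c f z)) | f. trig_poly f}"

end

theory Submission
  imports Defs
begin

text \<open>
  In the Fourier basis \<open>e\<^sub>n = z\<^sup>n\<close> of \<open>L\<^sup>2(S\<^sup>1)\<close> both operators are weighted shifts: they send
  \<open>e\<^sub>n\<close> to \<open>w\<^sub>n e\<^sub>n\<close> and to \<open>w\<^sub>n e\<^sub>n\<^sub>+\<^sub>1\<close> respectively, with the same weights \<open>w\<^sub>n = \<beta>\<^sub>\<infinity> n + c\<close>.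
  So the statement is an instance of a criterion for weighted shifts \<open>D e\<^sub>i = w\<^sub>i e\<^bsub>s(i)\<^esub>\<close> in any
  Hilbert space with an orthonormal basis, where \<open>s\<close> is a bijection of the index set: \<open>D\<close> has
  compact parametrices iff \<open>\<bar>w\<^sub>i\<bar> \<rightarrow> \<infinity>\<close>, in the sense that only finitely many weights lie in any
  given disc (\<open>compact_parametrices_weighted_shift_iff\<close>). For \<open>w\<^sub>n = \<beta>\<^sub>\<infinity> n + c\<close> this means
  \<open>\<beta>\<^sub>\<infinity> \<noteq> 0\<close>.

  For the criterion, the closure of \<open>D\<close> from the span of the basis consists of all pairs
  \<open>(x, y)\<close> whose coefficients satisfy \<open>y\<^bsub>s(i)\<^esub> = w\<^sub>i x\<^sub>i\<close> (\<open>closure_graph_on_span\<close>), and its adjoint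
  is the weighted shift along \<open>s\<^sup>-\<^sup>1\<close> with conjugate weights (\<open>adjoint_weighted_shift\<close>). Hence
  \<open>(I + D\<^sup>* D)\<^sup>-\<^sup>1\<close> is the diagonal operator with entries \<open>1 / (1 + \<bar>w\<^sub>i\<bar>\<^sup>2)\<close>
  (\<open>inverse_id_plus_adjoint_comp\<close>), and its square root has entries \<open>(1 + \<bar>w\<^sub>i\<bar>\<^sup>2)\<^sup>-\<^sup>1\<^sup>/\<^sup>2\<close>. If these
  tend to \<open>0\<close>, the square root is compact. If infinitely many of them stay away from \<open>0\<close>, then no
  compact square root exists, since its square would be compact and would map infinitely many
  basis vectors to separated vectors. As \<open>D\<^sup>*\<close> is a weighted shift with weights of the same
  absolute values and \<open>D\<^sup>*\<^sup>* = D\<close>, the operator \<open>I + D D\<^sup>*\<close> needs no separate treatment.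

  What is special to the circle is that the functions \<open>z\<^sup>n\<close> form an orthonormal basis. Totality is
  the density of trigonometric polynomials (\<open>trig_poly_dense\<close>): they approximate continuous
  functions uniformly by the Stone--Weierstrass theorem, and continuous functions are dense in
  \<open>L\<^sup>2\<close> (\<open>closed_subspace_containing_continuous\<close>).
\<close>



section \<open>Complex inner product spaces\<close>

lemma cinner_add_right: "cinner x (y + z) = cinner x y + cinner x z"
  by (metis cinner_add_left cinner_commute complex_cnj_add)

lemma cinner_scaleC_right: "cinner x (scaleC a y) = cnj a * cinner x y"
  by (metis cinner_commute cinner_scaleC_left complex_cnj_mult)

lemma cinner_zero_left [simp]: "cinner 0 y = 0"
  using cinner_add_left[of 0 0 y] by simp

lemma cinner_zero_right [simp]: "cinner x 0 = 0"
  using cinner_add_right[of x 0 0] by simp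

lemma cinner_diff_left: "cinner (x - y) z = cinner x z - cinner y z"
  using cinner_add_left[of "x - y" y z] by simp

lemma cinner_sum_left: "cinner (\<Sum>i\<in>F. f i) y = (\<Sum>i\<in>F. cinner (f i) y)"
  by (induction F rule: infinite_finite_induct) (auto simp: cinner_add_left)

lemma cinner_sum_right: "cinner x (\<Sum>i\<in>F. f i) = (\<Sum>i\<in>F. cinner x (f i))"
  by (induction F rule: infinite_finite_induct) (auto simp: cinner_add_right)

lemma scaleC_zero_left [simp]: "scaleC 0 x = 0"
  using scaleC_of_real[of 0 x] by simp

lemma scaleC_one [simp]: "scaleC 1 x = x"
  using scaleC_of_real[of 1 x] by simp

lemma scaleC_diff_left: "scaleC (a - b) x = scaleC a x - scaleC b x"
  using scaleC_add_left[of "a - b" b x] by simp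

lemma cinner_self: "cinner x x = complex_of_real ((norm x)\<^sup>2)"
proof (rule complex_eqI)
  show "Re (cinner x x) = Re (complex_of_real ((norm x)\<^sup>2))"
    by (simp add: power2_norm_eq_inner inner_eq_Re_cinner del: of_real_power)
  have "Im (cinner x x) = Im (cnj (cinner x x))"
    using cinner_commute[of x x] by simp
  then show "Im (cinner x x) = Im (complex_of_real ((norm x)\<^sup>2))"
    by (simp del: of_real_power)
qed

lemma norm_scaleC: "norm (scaleC a x) = norm a * norm x"
proof -
  have "complex_of_real ((norm (scaleC a x))\<^sup>2) = (a * cnj a) * cinner x x"
    by (simp only: cinner_self[symmetric] cinner_scaleC_left cinner_scaleC_right mult_ac)
  also have "\<dots> = complex_of_real ((norm a * norm x)\<^sup>2)"
    by (simp add: cinner_self complex_norm_square[symmetric] power_mult_distrib)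
  finally have "(norm (scaleC a x))\<^sup>2 = (norm a * norm x)\<^sup>2"
    by (simp only: of_real_eq_iff)
  then show ?thesis
    by simp
qed

text \<open>
  Rotating the first vector by the phase of the inner product makes the complex inner product real
  and nonnegative, which reduces the claim to the real Cauchy--Schwarz inequality.
\<close>

lemma norm_cinner_le: "norm (cinner x y) \<le> norm x * norm y"
proof (cases "cinner x y = 0")
  case False
  define a where "a = cnj (sgn (cinner x y))"
  have "norm a = 1"
    using False by (simp add: a_def norm_sgn)
  have "a * cinner x y = complex_of_real (norm (cinner x y))"
    using False complex_norm_square[of "cinner x y"]
    by (simp add: a_def sgn_div_norm scaleR_conv_of_real field_simps power2_eq_square)
  then have "norm (cinner x y) = inner (scaleC a x) y"
    by (simp add: inner_eq_Re_cinner cinner_scaleC_left)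
  also have "\<dots> \<le> norm (scaleC a x) * norm y"
    by (rule norm_cauchy_schwarz)
  finally show ?thesis
    using \<open>norm a = 1\<close> by (simp add: norm_scaleC)
qed simp

lemma bounded_linear_cinner_left: "bounded_linear (\<lambda>x. cinner x y)"
proof (rule bounded_linear_intro)
  show "cinner (r *\<^sub>R x) y = r *\<^sub>R cinner x y" for r x
    by (simp add: scaleC_of_real[symmetric] cinner_scaleC_left scaleR_conv_of_real)
  show "norm (cinner x y) \<le> norm x * norm y" for x
    by (rule norm_cinner_le)
qed (rule cinner_add_left)

lemma continuous_on_cinner_left: "continuous_on S f \<Longrightarrow> continuous_on S (\<lambda>x. cinner (f x) y)"
  by (rule bounded_linear.continuous_on[OF bounded_linear_cinner_left])

lemma bounded_linear_scaleC: "bounded_linear (scaleC a :: 'a \<Rightarrow> 'a::complex_inner)"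
proof (rule bounded_linear_intro)
  show "scaleC a (r *\<^sub>R x) = r *\<^sub>R scaleC a x" for r and x :: 'a
    by (simp add: scaleC_of_real[symmetric] scaleC_scaleC mult.commute)
  show "norm (scaleC a x) \<le> norm x * norm a" for x :: 'a
    by (simp add: norm_scaleC mult.commute)
qed (rule scaleC_add_right)

lemma bounded_linear_scaleC_left: "bounded_linear (\<lambda>a. scaleC a x)"
proof (rule bounded_linear_intro)
  show "scaleC (r *\<^sub>R a) x = r *\<^sub>R scaleC a x" for r a
    by (simp add: scaleC_of_real[symmetric] scaleC_scaleC scaleR_conv_of_real)
  show "norm (scaleC a x) \<le> norm a * norm x" for a
    by (simp add: norm_scaleC)
qed (rule scaleC_add_left)


section \<open>Orthonormal bases\<close>

locale orthonormal_basis =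
  fixes e :: "'i \<Rightarrow> 'a::complex_hilbert"
  assumes cinner_basis: "cinner (e i) (e j) = (if i = j then 1 else 0)"
    and total: "0 < \<epsilon> \<Longrightarrow> \<exists>F a. finite F \<and> norm (x - (\<Sum>i\<in>F. scaleC (a i) (e i))) < \<epsilon>"
begin

abbreviation coef :: "'a \<Rightarrow> 'i \<Rightarrow> complex" where
  "coef x i \<equiv> cinner x (e i)"

lemma coef_sum:
  "finite F \<Longrightarrow> coef (\<Sum>i\<in>F. scaleC (a i) (e i)) j = (if j \<in> F then a j else 0)"
  by (simp add: cinner_sum_left cinner_scaleC_left cinner_basis if_distrib sum.delta cong: if_cong)

lemma norm_sum_square:
  assumes "finite F"
  shows "(norm (\<Sum>i\<in>F. scaleC (a i) (e i)))\<^sup>2 = (\<Sum>i\<in>F. (norm (a i))\<^sup>2)"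
proof -
  have "complex_of_real ((norm (\<Sum>i\<in>F. scaleC (a i) (e i)))\<^sup>2) = (\<Sum>i\<in>F. cnj (a i) * a i)"
    unfolding cinner_self[symmetric] cinner_sum_right cinner_scaleC_right
    by (intro sum.cong refl) (simp add: coef_sum assms)
  also have "\<dots> = complex_of_real (\<Sum>i\<in>F. (norm (a i))\<^sup>2)"
    by (simp add: complex_norm_square mult.commute del: of_real_power)
  finally show ?thesis
    by (simp only: of_real_eq_iff)
qed

lemma norm_basis [simp]: "norm (e i) = 1"
proof (rule power2_eq_imp_eq)
  show "(norm (e i))\<^sup>2 = 1\<^sup>2"
    using norm_sum_square[of "{i}" "\<lambda>_. 1"] by simp
qed simp_all

text \<open>The partial Fourier sum is the best approximation from the span of its basis vectors.\<close>

lemma partial_sum_best_approximation: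
  assumes "finite F"
  shows "norm (x - (\<Sum>i\<in>F. scaleC (coef x i) (e i))) \<le> norm (x - (\<Sum>i\<in>F. scaleC (a i) (e i)))"
proof -
  define u where "u = x - (\<Sum>i\<in>F. scaleC (coef x i) (e i))"
  define v where "v = (\<Sum>i\<in>F. scaleC (coef x i - a i) (e i))"
  have "cinner u v = 0"
    unfolding v_def cinner_sum_right cinner_scaleC_right
    by (intro sum.neutral) (simp add: u_def cinner_diff_left coef_sum assms)
  then have "orthogonal u v"
    by (simp add: orthogonal_def inner_eq_Re_cinner)
  then have "(norm (u + v))\<^sup>2 = (norm u)\<^sup>2 + (norm v)\<^sup>2"
    by (rule norm_add_Pythagorean)
  then have "norm u \<le> norm (u + v)"
    by (simp add: power2_le_imp_le)
  also have "u + v = x - (\<Sum>i\<in>F. scaleC (a i) (e i))"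
    by (simp add: u_def v_def scaleC_diff_left sum_subtractf)
  finally show ?thesis
    by (simp add: u_def)
qed

text \<open>
  Totality supplies one good approximation from the span; by best approximation the partial sums
  over all larger index sets are at least as good.
\<close>

lemma fourier_expansion: "((\<lambda>i. scaleC (coef x i) (e i)) has_sum x) UNIV"
  unfolding has_sum_def
proof (rule tendstoI)
  fix \<epsilon> :: real assume "0 < \<epsilon>"
  then obtain F a where F: "finite F" and a: "norm (x - (\<Sum>i\<in>F. scaleC (a i) (e i))) < \<epsilon>"
    using total by blast
  show "\<forall>\<^sub>F G in finite_subsets_at_top UNIV. dist (\<Sum>i\<in>G. scaleC (coef x i) (e i)) x < \<epsilon>"
    unfolding eventually_finite_subsets_at_top
  proof (intro exI[of _ F] conjI allI impI F subset_UNIV)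
    fix G assume G: "finite G \<and> F \<subseteq> G \<and> G \<subseteq> UNIV"
    have "(\<Sum>i\<in>G. scaleC (if i \<in> F then a i else 0) (e i)) = (\<Sum>i\<in>F. scaleC (a i) (e i))"
      using G by (intro sum.mono_neutral_cong_right) auto
    then show "dist (\<Sum>i\<in>G. scaleC (coef x i) (e i)) x < \<epsilon>"
      using partial_sum_best_approximation[of G x "\<lambda>i. if i \<in> F then a i else 0"] a G
      by (simp add: dist_norm norm_minus_commute)
  qed
qed

lemma coef_eqI:
  assumes "\<And>i. coef x i = coef y i"
  shows "x = y"
proof (rule has_sum_unique)
  show "((\<lambda>i. scaleC (coef x i) (e i)) has_sum x) UNIV"
    by (rule fourier_expansion)
  show "((\<lambda>i. scaleC (coef x i) (e i)) has_sum y) UNIV"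
    unfolding assms by (rule fourier_expansion)
qed

lemma parseval_cinner: "((\<lambda>i. coef x i * cnj (coef y i)) has_sum cinner x y) UNIV"
proof -
  have "((\<lambda>i. cinner (scaleC (coef x i) (e i)) y) has_sum cinner x y) UNIV"
    by (rule has_sum_bounded_linear[OF bounded_linear_cinner_left fourier_expansion])
  moreover have "cinner (scaleC (coef x i) (e i)) y = coef x i * cnj (coef y i)" for i
    using cinner_commute[of "e i" y] by (simp add: cinner_scaleC_left)
  ultimately show ?thesis
    by simp
qed

lemma parseval: "((\<lambda>i. (norm (coef x i))\<^sup>2) has_sum (norm x)\<^sup>2) UNIV"
proof -
  have "((\<lambda>i. Re (coef x i * cnj (coef x i))) has_sum Re (cinner x x)) UNIV"
    by (rule has_sum_bounded_linear[OF bounded_linear_Re parseval_cinner])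
  then show ?thesis
    by (simp only: cinner_self complex_norm_square[symmetric] Re_complex_of_real)
qed

text \<open>
  For nested finite index sets the squared distance of the partial sums is the difference of the
  partial sums of \<open>\<bar>a i\<bar>\<^sup>2\<close>, so Cauchy nets of reals give Cauchy nets of vectors.
\<close>

lemma riesz_fischer:
  assumes "(\<lambda>i. (norm (a i))\<^sup>2) summable_on UNIV"
  shows "\<exists>x. \<forall>i. coef x i = a i"
proof -
  let ?s = "\<lambda>F. \<Sum>i\<in>F. scaleC (a i) (e i)" and ?n = "\<lambda>F. \<Sum>i\<in>F. (norm (a i))\<^sup>2"
  from assms obtain S where S: "(?n \<longlongrightarrow> S) (finite_subsets_at_top UNIV)"
    by (auto simp: summable_on_def has_sum_def)
  have "\<exists>P. eventually P (finite_subsets_at_top UNIV) \<and>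
      (\<forall>F G. P F \<and> P G \<longrightarrow> dist (?s F) (?s G) < \<epsilon>)" if "0 < \<epsilon>" for \<epsilon>
  proof -
    have "\<forall>\<^sub>F F in finite_subsets_at_top UNIV. dist (?n F) S < (\<epsilon>/2)\<^sup>2 / 2"
      using S that by (intro tendstoD) auto
    then obtain F where F: "finite F"
      and near: "\<And>G. finite G \<Longrightarrow> F \<subseteq> G \<Longrightarrow> dist (?n G) S < (\<epsilon>/2)\<^sup>2 / 2"
      unfolding eventually_finite_subsets_at_top by auto
    have close: "dist (?s G) (?s F) < \<epsilon>/2" if "finite G" "F \<subseteq> G" for G
    proof -
      have "(norm (?s G - ?s F))\<^sup>2 = ?n G - ?n F"
        using that F by (simp add: sum_diff[symmetric] norm_sum_square)
      also have "\<dots> < (\<epsilon>/2)\<^sup>2"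
        using near[OF that] near[OF F order_refl] unfolding dist_real_def abs_less_iff by linarith
      finally show ?thesis
        unfolding dist_norm by (rule power2_less_imp_less) (simp add: \<open>0 < \<epsilon>\<close> less_imp_le)
    qed
    show ?thesis
    proof (intro exI conjI allI impI)
      show "eventually (\<lambda>G. finite G \<and> F \<subseteq> G) (finite_subsets_at_top UNIV)"
        using F by (auto simp: eventually_finite_subsets_at_top)
      fix G H assume "(finite G \<and> F \<subseteq> G) \<and> (finite H \<and> F \<subseteq> H)"
      then show "dist (?s G) (?s H) < \<epsilon>"
        using close[of G] close[of H] dist_triangle_half_l by blast
    qed
  qed
  then have "cauchy_filter (filtermap ?s (finite_subsets_at_top UNIV))"
    by (simp add: cauchy_filter_metric_filtermap)
  then obtain x where "filtermap ?s (finite_subsets_at_top UNIV) \<le> nhds x"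
    using cauchy_filter_complete_converges[OF _ complete_UNIV, of "filtermap ?s (finite_subsets_at_top UNIV)"]
    by (auto simp: filtermap_bot_iff)
  then have x: "((\<lambda>i. scaleC (a i) (e i)) has_sum x) UNIV"
    by (simp add: has_sum_def filterlim_def)
  have "coef x j = a j" for j
  proof (rule has_sum_unique)
    show "((\<lambda>i. coef (scaleC (a i) (e i)) j) has_sum coef x j) UNIV"
      by (rule has_sum_bounded_linear[OF bounded_linear_cinner_left x])
    have "((\<lambda>i. coef (scaleC (a i) (e i)) j) has_sum (\<Sum>i\<in>{j}. coef (scaleC (a i) (e i)) j)) UNIV"
      by (rule has_sum_finite_neutralI[where B = "{j}"]) (auto simp: cinner_scaleC_left cinner_basis)
    then show "((\<lambda>i. coef (scaleC (a i) (e i)) j) has_sum a j) UNIV"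
      by (simp add: cinner_scaleC_left cinner_basis)
  qed
  then show ?thesis by blast
qed


section \<open>Diagonal operators\<close>

text \<open>
  Bounded multipliers preserve square summability, so Riesz--Fischer applies. The bijection \<open>s\<close>
  makes the lemma usable for weighted shifts as well as for diagonal operators.
\<close>

lemma exists_multiplied_coefs:
  assumes s: "bij s" and d: "\<And>i. norm (d i) \<le> C"
  shows "\<exists>y. \<forall>i. coef y (s i) = d i * coef x i"
proof -
  have "(\<lambda>i. C\<^sup>2 * (norm (coef x i))\<^sup>2) summable_on UNIV"
    using parseval by (intro summable_on_cmult_right) (auto simp: summable_on_def)
  then have "(\<lambda>i. (norm (d i * coef x i))\<^sup>2) summable_on UNIV"
  proof (rule summable_on_comparison_test)
    show "(norm (d i * coef x i))\<^sup>2 \<le> C\<^sup>2 * (norm (coef x i))\<^sup>2" for i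
      using d by (simp add: norm_mult power_mult_distrib mult_right_mono power_mono)
  qed simp
  then have "(\<lambda>j. (norm (d (inv s j) * coef x (inv s j)))\<^sup>2) summable_on UNIV"
    using summable_on_reindex_bij_betw[OF bij_imp_bij_inv[OF s],
        of "\<lambda>i. (norm (d i * coef x i))\<^sup>2"] by simp
  from riesz_fischer[OF this] obtain y where "\<And>j. coef y j = d (inv s j) * coef x (inv s j)"
    by auto
  then have "\<forall>i. coef y (s i) = d i * coef x i"
    using s by (simp add: bij_is_inj)
  then show ?thesis ..
qed

text \<open>The vector described by \<open>THE\<close> exists as soon as the entries of \<open>d\<close> are bounded.\<close>

definition diagonal :: "('i \<Rightarrow> complex) \<Rightarrow> 'a \<Rightarrow> 'a" where
  "diagonal d x = (THE y. \<forall>i. coef y i = d i * coef x i)"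

context
  fixes d :: "'i \<Rightarrow> complex" and C :: real
  assumes d_le: "\<And>i. norm (d i) \<le> C"
begin

lemma coef_diagonal: "coef (diagonal d x) i = d i * coef x i"
proof -
  have "\<exists>!y. \<forall>i. coef y i = d i * coef x i"
    using exists_multiplied_coefs[where s = id and d = d and x = x, OF bij_id d_le] by (auto intro!: coef_eqI)
  then have "\<forall>i. coef (diagonal d x) i = d i * coef x i"
    unfolding diagonal_def by (rule theI')
  then show ?thesis by simp
qed

lemma norm_diagonal_le: "norm (diagonal d x) \<le> C * norm x"
proof (rule power2_le_imp_le)
  have "((\<lambda>i. C\<^sup>2 * (norm (coef x i))\<^sup>2) has_sum C\<^sup>2 * (norm x)\<^sup>2) UNIV"
    by (rule has_sum_cmult_right[OF parseval])
  from has_sum_mono[OF parseval this] show "(norm (diagonal d x))\<^sup>2 \<le> (C * norm x)\<^sup>2"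
    using d_le by (simp add: coef_diagonal norm_mult power_mult_distrib mult_right_mono power_mono)
  show "0 \<le> C * norm x"
    using order_trans[OF norm_ge_zero d_le] by (intro mult_nonneg_nonneg) auto
qed

lemma bounded_complex_linear_diagonal: "bounded_complex_linear (diagonal d)"
proof -
  have add: "diagonal d (x + y) = diagonal d x + diagonal d y" for x y
    by (rule coef_eqI) (simp add: coef_diagonal cinner_add_left distrib_left)
  have scale: "diagonal d (scaleC a x) = scaleC a (diagonal d x)" for a x
    by (rule coef_eqI) (simp add: coef_diagonal cinner_scaleC_left)
  have "bounded_linear (diagonal d)"
  proof (rule bounded_linear_intro[where K = C])
    show "diagonal d (r *\<^sub>R x) = r *\<^sub>R diagonal d x" for r x
      by (simp add: scaleC_of_real[symmetric] scale)
    show "norm (diagonal d x) \<le> norm x * C" for x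
      using norm_diagonal_le[of x] by (simp add: mult.commute)
  qed (rule add)
  then show ?thesis
    by (simp add: bounded_complex_linear_def scale)
qed

lemma positive_diagonal:
  assumes "\<And>i. d i \<in> \<real>\<^sub>\<ge>\<^sub>0"
  shows "positive_operator (diagonal d)"
  unfolding positive_operator_def
proof (intro conjI allI bounded_complex_linear_diagonal)
  fix x
  have sum: "((\<lambda>i. d i * complex_of_real ((norm (coef x i))\<^sup>2)) has_sum cinner (diagonal d x) x) UNIV"
    using parseval_cinner[of "diagonal d x" x]
    by (simp add: coef_diagonal mult.assoc complex_norm_square del: of_real_power)
  have re: "0 \<le> Re (d i)" and im: "Im (d i) = 0" for i
    using assms[of i] by (auto simp: complex_nonneg_Reals_iff)
  have "0 \<le> Re (cinner (diagonal d x) x)"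
    by (rule has_sum_nonneg[OF has_sum_bounded_linear[OF bounded_linear_Re sum]])
      (simp add: re del: of_real_power)
  moreover have "Im (cinner (diagonal d x) x) = 0"
  proof (rule has_sum_unique[OF has_sum_bounded_linear[OF bounded_linear_Im sum]])
    show "((\<lambda>i. Im (d i * complex_of_real ((norm (coef x i))\<^sup>2))) has_sum 0) UNIV"
      by (simp add: im del: of_real_power)
  qed
  ultimately show "cinner (diagonal d x) x \<in> \<real>\<^sub>\<ge>\<^sub>0"
    by (simp add: complex_nonneg_Reals_iff)
qed

end

lemma compact_bounded_combinations:
  assumes "finite F"
  shows "compact {\<Sum>i\<in>F. scaleC (a i) (e i) | a. \<forall>i. norm (a i) \<le> C}" (is "compact (?K F)")
  using assms
proof (induction F)
  case empty
  have "?K {} \<subseteq> {0}" by auto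
  then have "finite (?K {})" by (rule finite_subset) simp
  then show ?case by (rule finite_imp_compact)
next
  case (insert j F)
  let ?g = "\<lambda>(b :: complex, y). scaleC b (e j) + y"
  have "?K (insert j F) = ?g ` (cball 0 C \<times> ?K F)" (is "_ = ?R")
  proof (intro equalityI subsetI)
    fix y assume "y \<in> ?K (insert j F)"
    then obtain a where "\<forall>i. norm (a i) \<le> C" "y = ?g (a j, \<Sum>i\<in>F. scaleC (a i) (e i))"
      using insert.hyps by auto
    moreover from this have "(a j, \<Sum>i\<in>F. scaleC (a i) (e i)) \<in> cball 0 C \<times> ?K F"
      by auto
    ultimately show "y \<in> ?R" by (simp only: imageI)
  next
    fix y assume "y \<in> ?R"
    then obtain b a where b: "norm b \<le> C" and a: "\<forall>i. norm (a i) \<le> C"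
      and y: "y = scaleC b (e j) + (\<Sum>i\<in>F. scaleC (a i) (e i))"
      by auto
    have "(\<Sum>i\<in>F. scaleC (a i) (e i)) = (\<Sum>i\<in>F. scaleC ((a(j := b)) i) (e i))"
      using insert.hyps by (intro sum.cong) auto
    then have "y = (\<Sum>i\<in>insert j F. scaleC ((a(j := b)) i) (e i))"
      using insert.hyps y by simp
    moreover have "\<forall>i. norm ((a(j := b)) i) \<le> C"
      using a b by simp
    ultimately show "y \<in> ?K (insert j F)" by blast
  qed
  moreover have "compact ?R"
  proof (rule compact_continuous_image)
    show "continuous_on (cball 0 C \<times> ?K F) ?g"
      unfolding split_beta
      by (intro continuous_intros bounded_linear.continuous_on[OF bounded_linear_scaleC_left])
    show "compact (cball (0::complex) C \<times> ?K F)"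
      by (rule compact_Times[OF _ insert.IH]) simp
  qed
  ultimately show ?case by simp
qed

text \<open>
  A diagonal operator whose entries tend to \<open>0\<close> is a norm limit of its finite-rank truncations,
  so the image of the unit ball is totally bounded.
\<close>

lemma compact_diagonal:
  assumes d: "\<And>\<epsilon>. 0 < \<epsilon> \<Longrightarrow> finite {i. \<epsilon> \<le> norm (d i)}"
  shows "compact_operator (diagonal d)"
proof -
  \<comment> \<open>Only finitely many entries exceed \<open>1\<close>, so the entries are bounded.\<close>
  define C where "C = Max (insert 1 (norm ` d ` {i. 1 \<le> norm (d i)}))"
  have C: "norm (d i) \<le> C" for i
  proof (cases "1 \<le> norm (d i)")
    case True
    then show ?thesis unfolding C_def using d[of 1] by (intro Max_ge) auto
  next
    case False
    then have "norm (d i) \<le> 1" by simp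
    also have "1 \<le> C" unfolding C_def using d[of 1] by (intro Max_ge) auto
    finally show ?thesis .
  qed
  let ?S = "diagonal d ` cball 0 1"
  have "\<exists>k. finite k \<and> closure ?S \<subseteq> (\<Union>y\<in>k. ball y \<epsilon>)" if "0 < \<epsilon>" for \<epsilon>
  proof -
    define F where "F = {i. \<epsilon>/4 \<le> norm (d i)}"
    have F: "finite F" using d[of "\<epsilon>/4"] that by (simp add: F_def)
    \<comment> \<open>The part of the operator on \<open>F\<close> maps the unit ball into the compact set \<open>?K\<close>; the
      remainder, with entries \<open>d'\<close>, has norm at most \<open>\<epsilon>/4\<close>.\<close>
    define d' where "d' i = (if i \<in> F then 0 else d i)" for i
    have d': "norm (d' i) \<le> \<epsilon>/4" for i
      using that by (auto simp: d'_def F_def)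
    let ?K = "{\<Sum>i\<in>F. scaleC (a i) (e i) | a. \<forall>i. norm (a i) \<le> C}"
    have "0 < \<epsilon>/4" using that by simp
    then obtain k where k: "finite k" "?K \<subseteq> (\<Union>y\<in>k. ball y (\<epsilon>/4))"
      using compact_bounded_combinations[OF F, of C] unfolding compact_eq_totally_bounded by blast
    have "?S \<subseteq> (\<Union>y\<in>k. cball y (\<epsilon>/2))"
    proof
      fix z assume "z \<in> ?S"
      then obtain x where x: "norm x \<le> 1" and z: "z = diagonal d x" by auto
      define w where "w = (\<Sum>i\<in>F. scaleC (if i \<in> F then d i * coef x i else 0) (e i))"
      have "norm (d i * coef x i) \<le> C" for i
      proof -
        have "norm (coef x i) \<le> norm x * norm (e i)"
          by (rule norm_cinner_le)
        then have "norm (coef x i) \<le> 1" using x by simp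
        then have "norm (d i) * norm (coef x i) \<le> C * 1"
          using C[of i] order_trans[OF norm_ge_zero C[of i]] by (intro mult_mono) auto
        then show ?thesis by (simp add: norm_mult)
      qed
      moreover have "0 \<le> C" using C[of undefined] norm_ge_zero order_trans by blast
      ultimately have "w \<in> ?K" unfolding w_def by fastforce
      then obtain y where y: "y \<in> k" "dist y w < \<epsilon>/4" using k by auto
      have "z - w = diagonal d' x"
        by (rule coef_eqI)
          (auto simp: z w_def cinner_diff_left coef_diagonal[where d = d, OF C]
            coef_diagonal[where d = d', OF d'] coef_sum F d'_def)
      then have "dist w z \<le> \<epsilon>/4 * norm x"
        using norm_diagonal_le[where d = d' and x = x, OF d'] by (simp add: dist_norm norm_minus_commute[of w z])
      also have "\<dots> \<le> \<epsilon>/4 * 1" using x that by (intro mult_left_mono) auto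
      finally have "dist y z \<le> \<epsilon>/2"
        using y(2) dist_triangle[of y z w] by linarith
      then show "z \<in> (\<Union>y\<in>k. cball y (\<epsilon>/2))" using y(1) by auto
    qed
    then have "closure ?S \<subseteq> (\<Union>y\<in>k. cball y (\<epsilon>/2))"
      by (rule closure_minimal) (use k in auto)
    also have "\<dots> \<subseteq> (\<Union>y\<in>k. ball y \<epsilon>)" using that by auto
    finally show ?thesis using k(1) by blast
  qed
  then have "compact (closure ?S)"
    by (simp add: compact_eq_totally_bounded complete_eq_closed)
  then show ?thesis
    by (simp add: compact_operator_def bounded_complex_linear_diagonal[where d = d, OF C])
qed

text \<open>
  Infinitely many pairwise orthogonal vectors of length at least \<open>\<delta>\<close> are pairwise at distance
  at least \<open>\<delta>\<close>, which total boundedness forbids.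
\<close>

lemma not_compact_if_scaled_basis:
  assumes J: "infinite J" and "0 < \<delta>" and d: "\<And>i. i \<in> J \<Longrightarrow> \<delta> \<le> norm (d i)"
    and S: "\<And>i. i \<in> J \<Longrightarrow> scaleC (d i) (e i) \<in> S"
  shows "\<not> compact S"
proof
  assume "compact S"
  then obtain k where k: "finite k" "S \<subseteq> (\<Union>y\<in>k. ball y (\<delta>/2))"
    using half_gt_zero[OF \<open>0 < \<delta>\<close>] unfolding compact_eq_totally_bounded by blast
  have "\<exists>y\<in>k. dist y (scaleC (d i) (e i)) < \<delta>/2" if "i \<in> J" for i
    using subsetD[OF k(2) S[OF that]] by auto
  then obtain g where g: "\<And>i. i \<in> J \<Longrightarrow> g i \<in> k"
    and near: "\<And>i. i \<in> J \<Longrightarrow> dist (g i) (scaleC (d i) (e i)) < \<delta>/2" by metis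
  have "inj_on g J"
  proof (rule inj_onI, rule ccontr)
    fix i j assume i: "i \<in> J" and j: "j \<in> J" and "g i = g j" "i \<noteq> j"
    then have "dist (scaleC (d i) (e i)) (scaleC (d j) (e j)) < \<delta>"
      using near[OF i] near[OF j]
        dist_triangle_half_r[of "g i" "scaleC (d i) (e i)" \<delta> "scaleC (d j) (e j)"] by simp
    moreover have "norm (coef (scaleC (d i) (e i) - scaleC (d j) (e j)) i) = norm (d i)"
      using \<open>i \<noteq> j\<close> by (simp add: cinner_diff_left cinner_scaleC_left cinner_basis)
    ultimately have "norm (d i) < \<delta>"
      using norm_cinner_le[of "scaleC (d i) (e i) - scaleC (d j) (e j)" "e i"]
      by (simp add: dist_norm)
    then show False using d[OF i] by simp
  qed
  moreover have "finite (g ` J)"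
    using g k(1) by (auto intro: finite_subset)
  ultimately show False
    using J finite_imageD by blast
qed


section \<open>Weighted shifts\<close>

definition weighted_shift :: "('i \<Rightarrow> 'i) \<Rightarrow> ('i \<Rightarrow> complex) \<Rightarrow> ('a \<times> 'a) set" where
  "weighted_shift s w = {(x, y). \<forall>i. coef y (s i) = w i * coef x i}"

lemma weighted_shiftI: "(\<And>i. coef y (s i) = w i * coef x i) \<Longrightarrow> (x, y) \<in> weighted_shift s w"
  by (simp add: weighted_shift_def)

lemma weighted_shiftD: "(x, y) \<in> weighted_shift s w \<Longrightarrow> coef y (s i) = w i * coef x i"
  by (simp add: weighted_shift_def)

lemma closed_weighted_shift: "closed (weighted_shift s w)"
proof -
  have eq: "weighted_shift s w = {p. \<forall>i. coef (snd p) (s i) = w i * coef (fst p) i}"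
    by (auto simp: weighted_shift_def)
  show ?thesis
    unfolding eq
    by (intro closed_Collect_all closed_Collect_eq continuous_intros continuous_on_cinner_left)
qed

lemma span_pair_in_weighted_shift:
  assumes "bij s" and F: "finite F"
  shows "(\<Sum>i\<in>F. scaleC (a i) (e i), \<Sum>i\<in>F. scaleC (w i * a i) (e (s i))) \<in> weighted_shift s w"
proof -
  have "coef (\<Sum>i\<in>F. scaleC (b i) (e (s i))) (s j) = (if j \<in> F then b j else 0)" for b j
    using assms
    by (simp add: cinner_sum_left cinner_scaleC_left cinner_basis bij_is_inj[THEN inj_eq]
        if_distrib cong: if_cong)
  then show ?thesis
    by (intro weighted_shiftI) (simp add: coef_sum[OF F])
qed

text \<open>
  Truncating the two Fourier expansions of a pair in the graph to corresponding basis vectors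
  gives pairs in the graph over the span, which converge to the given pair.
\<close>

lemma closure_graph_on_span:
  assumes s: "bij s"
  shows "closure {(\<Sum>i\<in>F. scaleC (a i) (e i), \<Sum>i\<in>F. scaleC (w i * a i) (e (s i))) | F a. finite F}
    = weighted_shift s w" (is "closure ?G = _")
proof
  have "?G \<subseteq> weighted_shift s w"
    using span_pair_in_weighted_shift[OF s] by blast
  then show "closure ?G \<subseteq> weighted_shift s w"
    by (rule closure_minimal) (rule closed_weighted_shift)
next
  show "weighted_shift s w \<subseteq> closure ?G"
  proof safe
    fix x y assume xy: "(x, y) \<in> weighted_shift s w"
    have "((\<lambda>i. scaleC (coef y (s i)) (e (s i))) has_sum y) UNIV"
      using has_sum_reindex_bij_betw[OF s, of "\<lambda>i. scaleC (coef y i) (e i)"] fourier_expansion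
      by simp
    then have "((\<lambda>i. scaleC (w i * coef x i) (e (s i))) has_sum y) UNIV"
      by (simp only: weighted_shiftD[OF xy])
    then have lim: "((\<lambda>F. (\<Sum>i\<in>F. scaleC (coef x i) (e i),
        \<Sum>i\<in>F. scaleC (w i * coef x i) (e (s i)))) \<longlongrightarrow> (x, y)) (finite_subsets_at_top UNIV)"
      using fourier_expansion[of x] unfolding has_sum_def by (rule tendsto_Pair[rotated])
    show "(x, y) \<in> closure ?G"
    proof (rule Lim_in_closed_set[OF closed_closure _ _ lim])
      show "\<forall>\<^sub>F F in finite_subsets_at_top UNIV. (\<Sum>i\<in>F. scaleC (coef x i) (e i),
          \<Sum>i\<in>F. scaleC (w i * coef x i) (e (s i))) \<in> closure ?G"
      proof (intro eventually_finite_subsets_at_top_weakI subsetD[OF closure_subset] CollectI)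
        fix F :: "'i set" assume "finite F"
        then show "\<exists>G a. (\<Sum>i\<in>F. scaleC (coef x i) (e i), \<Sum>i\<in>F. scaleC (w i * coef x i) (e (s i)))
          = (\<Sum>i\<in>G. scaleC (a i) (e i), \<Sum>i\<in>G. scaleC (w i * a i) (e (s i))) \<and> finite G"
          by (intro exI[of _ F] exI[of _ "coef x"]) simp
      qed
    qed simp
  qed
qed

lemma closed_densely_defined_weighted_shift:
  assumes s: "bij s"
  shows "closed_densely_defined (weighted_shift s w)"
  unfolding closed_densely_defined_def
proof (intro conjI)
  show "complex_linear_graph (weighted_shift s w)"
    by (simp add: complex_linear_graph_def weighted_shift_def cinner_add_left cinner_scaleC_left
        distrib_left)
  show "single_valued (weighted_shift s w)"
  proof (rule single_valuedI)
    fix x y z assume y: "(x, y) \<in> weighted_shift s w" and z: "(x, z) \<in> weighted_shift s w"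
    show "y = z"
    proof (rule coef_eqI)
      fix j
      have "s (inv s j) = j" using s by (simp add: bij_is_surj surj_f_inv_f)
      then show "coef y j = coef z j"
        using weighted_shiftD[OF y, of "inv s j"] weighted_shiftD[OF z, of "inv s j"] by simp
    qed
  qed
  show "closed (weighted_shift s w)"
    by (rule closed_weighted_shift)
  have "x \<in> closure (Domain (weighted_shift s w))" for x
  proof (rule Lim_in_closed_set[OF closed_closure _ _ fourier_expansion[unfolded has_sum_def]])
    have "(\<Sum>i\<in>F. scaleC (coef x i) (e i)) \<in> Domain (weighted_shift s w)" if "finite F" for F
      by (rule DomainI[OF span_pair_in_weighted_shift[OF s that]])
    then show "\<forall>\<^sub>F F in finite_subsets_at_top UNIV.
        (\<Sum>i\<in>F. scaleC (coef x i) (e i)) \<in> closure (Domain (weighted_shift s w))"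
      by (intro eventually_finite_subsets_at_top_weakI subsetD[OF closure_subset])
  qed simp
  then show "closure (Domain (weighted_shift s w)) = UNIV" by blast
qed

text \<open>
  Testing the adjoint relation on the pairs \<open>(e i, w i e (s i))\<close> determines the coefficients;
  conversely the two inner products have the same Parseval series.
\<close>

lemma adjoint_weighted_shift:
  assumes s: "bij s"
  shows "adjoint_graph (weighted_shift s w) = weighted_shift (inv s) (\<lambda>j. cnj (w (inv s j)))"
proof -
  have inv_s: "inv s (s i) = i" "s (inv s i) = i" for i
    using s by (simp_all add: bij_is_inj bij_is_surj surj_f_inv_f)
  have "(y, z) \<in> adjoint_graph (weighted_shift s w) \<longleftrightarrow> (\<forall>i. coef z i = cnj (w i) * coef y (s i))"
    for y z
  proof
    assume adj: "(y, z) \<in> adjoint_graph (weighted_shift s w)"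
    show "\<forall>i. coef z i = cnj (w i) * coef y (s i)"
    proof
      fix i
      have "(e i, scaleC (w i) (e (s i))) \<in> weighted_shift s w"
        using s by (intro weighted_shiftI)
          (auto simp: cinner_scaleC_left cinner_basis dest: bij_is_inj injD)
      then have "cinner (scaleC (w i) (e (s i))) y = cinner (e i) z"
        using adj by (auto simp: adjoint_graph_def)
      then have "cnj (cinner (e i) z) = cnj (w i * cinner (e (s i)) y)"
        by (simp add: cinner_scaleC_left)
      then show "coef z i = cnj (w i) * coef y (s i)"
        by (simp add: cinner_commute[of z "e i"] cinner_commute[of y "e (s i)"])
    qed
  next
    assume z: "\<forall>i. coef z i = cnj (w i) * coef y (s i)"
    have "cinner v y = cinner x z" if xv: "(x, v) \<in> weighted_shift s w" for x v
    proof (rule has_sum_unique)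
      show "((\<lambda>i. coef v (s i) * cnj (coef y (s i))) has_sum cinner v y) UNIV"
        using has_sum_reindex_bij_betw[OF s, of "\<lambda>i. coef v i * cnj (coef y i)"] parseval_cinner
        by simp
      show "((\<lambda>i. coef v (s i) * cnj (coef y (s i))) has_sum cinner x z) UNIV"
        using parseval_cinner[of x z] by (simp add: z weighted_shiftD[OF xv] mult_ac)
    qed
    then show "(y, z) \<in> adjoint_graph (weighted_shift s w)"
      by (auto simp: adjoint_graph_def)
  qed
  moreover have "(\<forall>i. coef z i = cnj (w i) * coef y (s i)) \<longleftrightarrow>
      (\<forall>j. coef z (inv s j) = cnj (w (inv s j)) * coef y j)" for y z
    by (metis inv_s)
  ultimately show ?thesis
    by (auto simp: weighted_shift_def)
qed

text \<open>
  The operator \<open>I + D\<^sup>* D\<close> multiplies the \<open>i\<close>-th coefficient by \<open>1 + \<bar>w i\<bar>\<^sup>2\<close>. It is onto because both the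
  inverse and \<open>D\<close> applied to it have bounded weights.
\<close>

lemma inverse_id_plus_adjoint_comp:
  assumes s: "bij s"
  shows "(id_plus_comp (adjoint_graph (weighted_shift s w)) (weighted_shift s w))\<inverse>
    = {(u, diagonal (\<lambda>i. complex_of_real (1 / (1 + (norm (w i))\<^sup>2))) u) | u. True}"
proof -
  have inv_s: "inv s (s i) = i" "s (inv s i) = i" for i
    using s by (simp_all add: bij_is_inj bij_is_surj surj_f_inv_f)
  define q where "q i = complex_of_real (1 / (1 + (norm (w i))\<^sup>2))" for i
  have pos: "1 + (norm (w i))\<^sup>2 > 0" for i
    by (rule add_pos_nonneg) auto
  have q_le: "norm (q i) \<le> 1" for i
    using pos[of i] by (simp add: q_def norm_divide del: of_real_divide of_real_power)
  have q_inv: "q i * (1 + cnj (w i) * w i) = 1" for i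
  proof -
    have "1 + cnj (w i) * w i = complex_of_real (1 + (norm (w i))\<^sup>2)"
      by (simp add: complex_norm_square mult.commute del: of_real_power)
    then show ?thesis
      unfolding q_def using pos[of i] by (simp only: of_real_mult[symmetric]) simp
  qed
  \<comment> \<open>The bounds on \<open>q i\<close> and \<open>w i * q i\<close> are what yields vectors \<open>x\<close> and \<open>D x\<close> for every \<open>u\<close>.\<close>
  have wq_le: "norm (w i * q i) \<le> 1" for i
  proof -
    have "0 \<le> (norm (w i) - 1)\<^sup>2" by simp
    then have "norm (w i) \<le> 1 + (norm (w i))\<^sup>2"
      by (simp add: power2_diff) (use norm_ge_zero[of "w i"] in linarith)
    then show ?thesis
      using pos[of i] by (simp add: q_def norm_mult norm_divide del: of_real_divide of_real_power)
  qed
  have "(x, u) \<in> id_plus_comp (adjoint_graph (weighted_shift s w)) (weighted_shift s w) \<longleftrightarrow>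
      x = diagonal q u" for x u
  proof
    assume "(x, u) \<in> id_plus_comp (adjoint_graph (weighted_shift s w)) (weighted_shift s w)"
    then obtain y z where u: "u = x + z" and y: "(x, y) \<in> weighted_shift s w"
      and z: "(y, z) \<in> weighted_shift (inv s) (\<lambda>j. cnj (w (inv s j)))"
      by (auto simp: id_plus_comp_def adjoint_weighted_shift[OF s])
    show "x = diagonal q u"
    proof (rule coef_eqI)
      fix i
      have "coef z i = cnj (w i) * coef y (s i)"
        using weighted_shiftD[OF z, of "s i"] by (simp add: inv_s)
      then have "coef u i = (1 + cnj (w i) * w i) * coef x i"
        by (simp add: u cinner_add_left weighted_shiftD[OF y] algebra_simps)
      then have "q i * coef u i = coef x i"
        by (simp only: mult.assoc[symmetric] q_inv mult_1)
      then show "coef x i = coef (diagonal q u) i"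
        by (simp add: coef_diagonal[where d = q, OF q_le])
    qed
  next
    assume x: "x = diagonal q u"
    have coef_x: "coef x i = q i * coef u i" for i
      by (simp add: x coef_diagonal[where d = q, OF q_le])
    obtain y where y: "\<And>i. coef y (s i) = (w i * q i) * coef u i"
      using exists_multiplied_coefs[where d = "\<lambda>i. w i * q i" and x = u, OF s wq_le] by auto
    have "(x, y) \<in> weighted_shift s w"
      by (rule weighted_shiftI) (simp add: y coef_x)
    moreover have "(y, u - x) \<in> weighted_shift (inv s) (\<lambda>j. cnj (w (inv s j)))"
    proof (rule weighted_shiftI)
      fix j
      let ?i = "inv s j"
      have "coef (u - x) ?i = (q ?i * (1 + cnj (w ?i) * w ?i)) * coef u ?i - q ?i * coef u ?i"
        by (simp add: cinner_diff_left coef_x q_inv)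
      also have "\<dots> = cnj (w ?i) * coef y (s ?i)"
        by (simp add: y algebra_simps)
      finally show "coef (u - x) ?i = cnj (w ?i) * coef y j"
        by (simp add: inv_s)
    qed
    ultimately have "(x, x + (u - x)) \<in>
        id_plus_comp (adjoint_graph (weighted_shift s w)) (weighted_shift s w)"
      unfolding id_plus_comp_def adjoint_weighted_shift[OF s] by blast
    then show "(x, u) \<in> id_plus_comp (adjoint_graph (weighted_shift s w)) (weighted_shift s w)"
      by simp
  qed
  then show ?thesis
    unfolding q_def[abs_def, symmetric] by (auto simp: converse_iff)
qed

lemma compact_inverse_sqrt_weighted_shift:
  assumes s: "bij s" and w: "\<And>R. finite {i. norm (w i) \<le> R}"
  shows "\<exists>B. inverse_sqrt (id_plus_comp (adjoint_graph (weighted_shift s w)) (weighted_shift s w)) B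
    \<and> compact_operator B"
proof -
  define p where "p i = complex_of_real (1 / sqrt (1 + (norm (w i))\<^sup>2))" for i
  have root_ge: "1 \<le> sqrt (1 + (norm (w i))\<^sup>2)" and norm_le_root: "norm (w i) \<le> sqrt (1 + (norm (w i))\<^sup>2)"
    for i by (simp_all add: real_le_rsqrt)
  have root_pos: "0 < sqrt (1 + (norm (w i))\<^sup>2)" for i
    using root_ge[of i] by linarith
  have norm_p: "norm (p i) = 1 / sqrt (1 + (norm (w i))\<^sup>2)" for i
    using root_ge[of i] unfolding p_def norm_of_real by simp
  have p_le: "norm (p i) \<le> 1" for i
    using root_ge[of i] unfolding norm_p by (subst divide_le_eq_1_pos) linarith+
  have "diagonal p (diagonal p u) = diagonal (\<lambda>i. complex_of_real (1 / (1 + (norm (w i))\<^sup>2))) u" for u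
  proof (rule coef_eqI)
    fix i
    have pp: "p i * p i = complex_of_real (1 / (1 + (norm (w i))\<^sup>2))" for i
      unfolding p_def of_real_mult[symmetric] by (simp del: of_real_divide of_real_power)
    have "norm (complex_of_real (1 / (1 + (norm (w i))\<^sup>2))) \<le> 1" for i
      unfolding pp[symmetric] norm_mult using p_le[of i] by (intro mult_le_one) auto
    then show "coef (diagonal p (diagonal p u)) i
        = coef (diagonal (\<lambda>i. complex_of_real (1 / (1 + (norm (w i))\<^sup>2))) u) i"
      by (simp add: coef_diagonal[where d = p, OF p_le] mult.assoc[symmetric] pp
          coef_diagonal[where d = "\<lambda>i. complex_of_real (1 / (1 + (norm (w i))\<^sup>2))" and C = 1]
          del: of_real_divide)
  qed
  moreover have "p i \<in> \<real>\<^sub>\<ge>\<^sub>0" for i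
    by (simp add: p_def del: of_real_divide)
  then have "positive_operator (diagonal p)"
    by (rule positive_diagonal[where d = p, OF p_le])
  ultimately have
    "inverse_sqrt (id_plus_comp (adjoint_graph (weighted_shift s w)) (weighted_shift s w)) (diagonal p)"
    by (simp add: inverse_sqrt_def inverse_id_plus_adjoint_comp[OF s])
  moreover have "compact_operator (diagonal p)"
  proof (rule compact_diagonal)
    fix \<epsilon> :: real assume "0 < \<epsilon>"
    have "norm (w i) \<le> 1/\<epsilon>" if "\<epsilon> \<le> norm (p i)" for i
    proof -
      have "sqrt (1 + (norm (w i))\<^sup>2) \<le> 1/\<epsilon>"
        using that \<open>0 < \<epsilon>\<close> root_pos[of i] unfolding norm_p
        by (simp only: pos_le_divide_eq mult.commute)
      then show ?thesis using norm_le_root[of i] by linarith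
    qed
    then show "finite {i. \<epsilon> \<le> norm (p i)}"
      by (intro finite_subset[OF _ w[of "1/\<epsilon>"]]) auto
  qed
  ultimately show ?thesis by blast
qed

text \<open>
  For the converse the square root need not be identified: if \<open>B\<close> is compact then so is
  \<open>B \<circ> B = (I + D\<^sup>* D)\<^sup>-\<^sup>1\<close>, which is diagonal.
\<close>

lemma finite_bounded_weights_if_compact:
  assumes s: "bij s"
    and B: "inverse_sqrt (id_plus_comp (adjoint_graph (weighted_shift s w)) (weighted_shift s w)) B"
    and "compact_operator B"
  shows "finite {i. norm (w i) \<le> R}"
proof (rule ccontr)
  assume inf: "infinite {i. norm (w i) \<le> R}"
  define q where "q i = complex_of_real (1 / (1 + (norm (w i))\<^sup>2))" for i
  have pos: "1 + (norm (w i))\<^sup>2 > 0" for i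
    by (rule add_pos_nonneg) auto
  have norm_q: "norm (q i) = 1 / (1 + (norm (w i))\<^sup>2)" for i
    using pos[of i] unfolding q_def norm_of_real by simp
  have q_le: "norm (q i) \<le> 1" for i
    using pos[of i] unfolding norm_q by simp
  have "{(x, B (B x)) | x. True} = {(x, diagonal q x) | x. True}"
    using B unfolding inverse_sqrt_def inverse_id_plus_adjoint_comp[OF s] q_def by metis
  then have BB: "B (B x) = diagonal q x" for x
    by auto
  have blin: "bounded_linear B" and cpt: "compact (closure (B ` cball 0 1))"
    using \<open>compact_operator B\<close> by (auto simp: compact_operator_def bounded_complex_linear_def)
  have "compact (B ` closure (B ` cball 0 1))"
    by (intro compact_continuous_image cpt linear_continuous_on blin)
  moreover have "\<not> compact (B ` closure (B ` cball 0 1))"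
  proof (rule not_compact_if_scaled_basis[OF inf])
    show "0 < 1 / (1 + R\<^sup>2)"
      by (simp add: add_pos_nonneg)
    fix i assume i: "i \<in> {i. norm (w i) \<le> R}"
    then have "(norm (w i))\<^sup>2 \<le> R\<^sup>2" by (intro power_mono) auto
    then show "1 / (1 + R\<^sup>2) \<le> norm (q i)"
      unfolding norm_q using pos[of i] by (intro divide_left_mono) (auto simp: add_pos_nonneg)
    have "scaleC (q i) (e i) = B (B (e i))"
      unfolding BB
      by (rule coef_eqI) (auto simp: coef_diagonal[where d = q, OF q_le] cinner_scaleC_left cinner_basis)
    moreover have "B (e i) \<in> closure (B ` cball 0 1)"
      by (rule subsetD[OF closure_subset]) simp
    ultimately show "scaleC (q i) (e i) \<in> B ` closure (B ` cball 0 1)"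
      by simp
  qed
  ultimately show False by contradiction
qed

text \<open>
  The adjoint of a weighted shift is again one, with weights of the same absolute values, and the
  double adjoint is the original graph; so both halves of the definition are instances of the same
  statement about \<open>I + D\<^sup>* D\<close>.
\<close>

theorem compact_parametrices_weighted_shift_iff:
  assumes s: "bij s"
  shows "has_compact_parametrices (weighted_shift s w) \<longleftrightarrow> (\<forall>R. finite {i. norm (w i) \<le> R})"
proof
  assume "has_compact_parametrices (weighted_shift s w)"
  then show "\<forall>R. finite {i. norm (w i) \<le> R}"
    using finite_bounded_weights_if_compact[OF s] by (auto simp: has_compact_parametrices_def)
next
  assume w: "\<forall>R. finite {i. norm (w i) \<le> R}"
  let ?D' = "weighted_shift (inv s) (\<lambda>j. cnj (w (inv s j)))"
  have s': "bij (inv s)" using s by (rule bij_imp_bij_inv)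
  have "adjoint_graph ?D' = weighted_shift s w"
    unfolding adjoint_weighted_shift[OF s'] using s by (simp add: inv_inv_eq bij_is_inj)
  moreover have "finite {j. norm (cnj (w (inv s j))) \<le> R}" for R
    using finite_vimageI[OF w[rule_format, of R] bij_is_inj[OF s']] by (simp add: vimage_def)
  then have "\<exists>B. inverse_sqrt (id_plus_comp (adjoint_graph ?D') ?D') B \<and> compact_operator B"
    by (rule compact_inverse_sqrt_weighted_shift[OF s'])
  ultimately show "has_compact_parametrices (weighted_shift s w)"
    using compact_inverse_sqrt_weighted_shift[OF s, of w] w closed_densely_defined_weighted_shift[OF s]
    unfolding has_compact_parametrices_def adjoint_weighted_shift[OF s] by simp
qed

end


section \<open>Classes of square-integrable functions\<close>

lemma L2_class_cong:
  assumes "square_integrable f" "square_integrable g" "\<And>z. norm z = 1 \<Longrightarrow> f z = g z"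
  shows "L2_class f = L2_class g"
proof (rule Quotient_rel_abs[OF Quotient_L2_circle])
  show "L2_rel f g"
    unfolding L2_rel_def using assms by (auto intro!: AE_I2)
qed

lemma L2_class_add:
  "square_integrable f \<Longrightarrow> square_integrable g \<Longrightarrow>
    L2_class (\<lambda>z. f z + g z) = L2_class f + L2_class g"
  by (simp add: plus_L2_circle.abs_eq L2_rel_def)

lemma L2_class_scaleC:
  "square_integrable f \<Longrightarrow> L2_class (\<lambda>z. a * f z) = scaleC a (L2_class f)"
  by (simp add: scaleC_L2_circle.abs_eq L2_rel_def)

lemma L2_class_zero: "L2_class (\<lambda>z. 0) = 0"
  by (simp add: zero_L2_circle_def)

lemma square_integrable_sum:
  "finite F \<Longrightarrow> (\<And>i. i \<in> F \<Longrightarrow> square_integrable (f i)) \<Longrightarrow> square_integrable (\<lambda>z. \<Sum>i\<in>F. f i z)"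
  by (induction F rule: finite_induct) (auto simp: square_integrable_zero square_integrable_add)

lemma L2_class_sum:
  "finite F \<Longrightarrow> (\<And>i. i \<in> F \<Longrightarrow> square_integrable (f i)) \<Longrightarrow>
    L2_class (\<lambda>z. \<Sum>i\<in>F. f i z) = (\<Sum>i\<in>F. L2_class (f i))"
  by (induction F rule: finite_induct)
    (auto simp: L2_class_zero L2_class_add square_integrable_sum)

lemma cinner_L2_class:
  "square_integrable f \<Longrightarrow> square_integrable g \<Longrightarrow>
    cinner (L2_class f) (L2_class g) = (\<integral>z. f z * cnj (g z) \<partial>circle_measure)"
  by (simp add: cinner_L2_circle.abs_eq L2_rel_def)

lemma square_integrable_bounded:
  assumes [measurable]: "f \<in> borel_measurable circle_measure"
    and C: "\<And>z. norm z = 1 \<Longrightarrow> norm (f z) \<le> C"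
  shows "square_integrable f"
proof -
  have "integrable circle_measure (\<lambda>z. (norm (f z))\<^sup>2)"
    by (rule finite_measure.integrable_const_bound[OF finite_measure_circle, of _ "C\<^sup>2"])
      (auto intro!: AE_I2 power_mono C)
  then show ?thesis by (simp add: square_integrable_def)
qed

lemma continuous_borel_measurable_circle:
  assumes "continuous_on (sphere 0 1) f"
  shows "f \<in> borel_measurable circle_measure"
proof -
  have "f \<in> borel_measurable (restrict_space borel (sphere 0 1))"
    using assms by (rule borel_measurable_continuous_on_restrict)
  then show ?thesis
    by (simp add: measurable_cong_sets[OF sets_circle_measure refl])
qed

lemma continuous_square_integrable:
  assumes "continuous_on (sphere 0 1) f"
  shows "square_integrable f"
proof -
  have "compact (f ` sphere 0 1)"
    by (intro compact_continuous_image assms) simp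
  then obtain C where "\<And>z. z \<in> sphere 0 1 \<Longrightarrow> norm (f z) \<le> C"
    using compact_imp_bounded bounded_iff by (metis imageI)
  then show ?thesis
    using continuous_borel_measurable_circle[OF assms] by (intro square_integrable_bounded) auto
qed

lemma norm_L2_class_le:
  assumes f: "square_integrable f" and C: "\<And>z. norm z = 1 \<Longrightarrow> norm (f z) \<le> C"
  shows "norm (L2_class f) \<le> C"
proof (rule power2_le_imp_le)
  interpret finite_measure circle_measure by (rule finite_measure_circle)
  have "measure circle_measure (sphere 0 1) = 1"
    using emeasure_circle_space by (simp add: measure_def)
  have "(norm (L2_class f))\<^sup>2 = (\<integral>z. (norm (f z))\<^sup>2 \<partial>circle_measure)"
    by (rule norm_L2_class[OF f])
  also have "\<dots> \<le> (\<integral>z. C\<^sup>2 \<partial>circle_measure)"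
    using f by (intro integral_mono) (auto simp: square_integrable_def intro!: power_mono C)
  also have "\<dots> = C\<^sup>2"
    using \<open>measure circle_measure (sphere 0 1) = 1\<close> by simp
  finally show "(norm (L2_class f))\<^sup>2 \<le> C\<^sup>2" .
  show "0 \<le> C"
    using order_trans[OF norm_ge_zero C[of 1]] by simp
qed

lemma L2_class_dominated_convergence:
  assumes [measurable]: "\<And>i::nat. g i \<in> borel_measurable circle_measure"
    and f: "square_integrable f" and h: "square_integrable h"
    and le: "\<And>i z. norm z = 1 \<Longrightarrow> norm (g i z) \<le> norm (h z)"
    and lim: "\<And>z. norm z = 1 \<Longrightarrow> (\<lambda>i. g i z) \<longlonglongrightarrow> f z"
  shows "(\<lambda>i. L2_class (g i)) \<longlonglongrightarrow> L2_class f"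
proof -
  note [measurable] = square_integrable_measurable[OF f]
  have g: "square_integrable (g i)" for i
    unfolding square_integrable_def
  proof
    show "integrable circle_measure (\<lambda>z. (norm (g i z))\<^sup>2)"
      by (rule Bochner_Integration.integrable_bound[where f = "\<lambda>z. (norm (h z))\<^sup>2"])
        (use h le in \<open>auto simp: square_integrable_def intro!: AE_I2 power_mono\<close>)
  qed measurable
  have "(\<lambda>i. \<integral>z. (norm (g i z - f z))\<^sup>2 \<partial>circle_measure) \<longlonglongrightarrow> (\<integral>z. 0 \<partial>circle_measure)"
  proof (rule integral_dominated_convergence[where w = "\<lambda>z. 2 * (norm (h z))\<^sup>2 + 2 * (norm (f z))\<^sup>2"])
    show "AE z in circle_measure. (\<lambda>i. (norm (g i z - f z))\<^sup>2) \<longlonglongrightarrow> 0"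
    proof (rule AE_I2)
      fix z assume "z \<in> space circle_measure"
      then have "(\<lambda>i. g i z - f z) \<longlonglongrightarrow> 0"
        using lim by (simp add: LIM_zero)
      then have "(\<lambda>i. (norm (g i z - f z))\<^sup>2) \<longlonglongrightarrow> (norm (0::complex))\<^sup>2"
        by (intro tendsto_intros)
      then show "(\<lambda>i. (norm (g i z - f z))\<^sup>2) \<longlonglongrightarrow> 0" by simp
    qed
    show "AE z in circle_measure. norm ((norm (g i z - f z))\<^sup>2) \<le> 2 * (norm (h z))\<^sup>2 + 2 * (norm (f z))\<^sup>2"
      for i
    proof (rule AE_I2)
      fix z assume z: "z \<in> space circle_measure"
      have "norm (g i z - f z) \<le> norm (h z) + norm (f z)"
        using norm_triangle_ineq4[of "g i z" "f z"] le[of z i] z by simp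
      then have "(norm (g i z - f z))\<^sup>2 \<le> (norm (h z) + norm (f z))\<^sup>2"
        by (intro power_mono) auto
      also have "\<dots> \<le> 2 * (norm (h z))\<^sup>2 + 2 * (norm (f z))\<^sup>2"
        using sum_squares_bound[of "norm (h z)" "norm (f z)"] by (simp add: power2_sum)
      finally show "norm ((norm (g i z - f z))\<^sup>2) \<le> 2 * (norm (h z))\<^sup>2 + 2 * (norm (f z))\<^sup>2"
        by simp
    qed
  qed (use f h in \<open>auto simp: square_integrable_def\<close>)
  then have "(\<lambda>i. (norm (L2_class (g i) - L2_class f))\<^sup>2) \<longlonglongrightarrow> 0"
    using f g by (simp add: L2_class_diff norm_L2_class square_integrable_diff)
  then have "(\<lambda>i. sqrt ((norm (L2_class (g i) - L2_class f))\<^sup>2)) \<longlonglongrightarrow> sqrt 0"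
    by (rule tendsto_real_sqrt)
  then have "(\<lambda>i. L2_class (g i) - L2_class f) \<longlonglongrightarrow> 0"
    by (simp add: tendsto_norm_zero_iff)
  then show ?thesis
    by (simp add: LIM_zero_iff)
qed

text \<open>
  Indicators of closed sets are monotone limits of continuous functions; Dynkin's argument passes
  to indicators of Borel sets, linear combinations to simple functions, and dominated convergence
  to all square-integrable functions.
\<close>

lemma closed_subspace_containing_continuous:
  assumes "closed S"
    and add: "\<And>x y. x \<in> S \<Longrightarrow> y \<in> S \<Longrightarrow> x + y \<in> S"
    and scale: "\<And>a x. x \<in> S \<Longrightarrow> scaleC a x \<in> S"
    and cont: "\<And>f. continuous_on (sphere 0 1) f \<Longrightarrow> L2_class f \<in> S"
  shows "x \<in> S"
proof -
  have lim_in: "l \<in> S" if "\<And>n. u n \<in> S" "u \<longlonglongrightarrow> l" for u :: "nat \<Rightarrow> L2_circle" and l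
    using \<open>closed S\<close> that by (auto simp: closed_sequential_limits)
  have zero: "0 \<in> S"
    using cont[of "\<lambda>z. 0"] by (simp add: L2_class_zero)
  have sum: "(\<Sum>i\<in>F. u i) \<in> S" if "finite F" "\<And>i. i \<in> F \<Longrightarrow> u i \<in> S"
    for F :: "'i set" and u :: "'i \<Rightarrow> L2_circle"
    using that by (induction F rule: finite_induct) (auto simp: zero add)
  let ?ind = "\<lambda>A z. indicator A z :: complex"
  have meas: "?ind A \<in> borel_measurable circle_measure" if "A \<in> sets borel" for A
  proof -
    have "?ind A \<in> borel_measurable (restrict_space borel (sphere 0 1))"
      using that by (intro measurable_restrict_space1 borel_measurable_indicator) simp
    then show ?thesis
      by (simp add: measurable_cong_sets[OF sets_circle_measure refl])
  qed
  have sq: "square_integrable (?ind A)" if "A \<in> sets borel" for A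
    by (rule square_integrable_bounded[OF meas[OF that], of 1]) (simp add: indicator_def)
  have one: "square_integrable (\<lambda>z. 1)"
    by (rule continuous_square_integrable) simp
  have sigma: "sets borel = sigma_sets UNIV (Collect (closed :: complex set \<Rightarrow> bool))"
    by (simp add: borel_eq_closed)
  have ind: "L2_class (?ind A) \<in> S" if "A \<in> sets borel" for A
  proof (rule sigma_sets_induct_disjoint[where A = A and P = "\<lambda>A. L2_class (?ind A) \<in> S",
        OF _ _ that[unfolded sigma]])
    show "Int_stable (Collect (closed :: complex set \<Rightarrow> bool))"
      by (auto simp: Int_stable_def)
  next
    fix A :: "complex set" assume A: "A \<in> Collect closed"
    show "L2_class (?ind A) \<in> S"
    proof (cases "A = {}")
      case True
      then show ?thesis using zero by (simp add: L2_class_zero)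
    next
      case False
      \<comment> \<open>Equal to \<open>1\<close> on \<open>A\<close> and to \<open>0\<close> at distance at least \<open>1/n\<close> from \<open>A\<close>.\<close>
      define g where "g n z = complex_of_real (max 0 (1 - real n * infdist z A))" for n z
      have g: "continuous_on (sphere 0 1) (g n)" for n
        unfolding g_def by (intro continuous_intros)
      have "(\<lambda>n. L2_class (g n)) \<longlonglongrightarrow> L2_class (?ind A)"
      proof (rule L2_class_dominated_convergence[OF continuous_borel_measurable_circle[OF g] _ one])
        show "square_integrable (?ind A)"
          using A by (intro sq) auto
        show "norm (g n z) \<le> norm (1::complex)" for n z
          by (simp add: g_def infdist_nonneg)
        show "(\<lambda>n. g n z) \<longlonglongrightarrow> ?ind A z" for z
        proof (cases "z \<in> A")
          case True
          then show ?thesis by (simp add: g_def)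
        next
          case False
          then have "0 < infdist z A"
            using A \<open>A \<noteq> {}\<close> by (simp add: infdist_pos_not_in_closed)
          then obtain N where N: "1 < real N * infdist z A"
            using reals_Archimedean3 by blast
          have "g n z = 0" if "N \<le> n" for n
          proof -
            have "real N * infdist z A \<le> real n * infdist z A"
              using that by (intro mult_right_mono) (auto simp: infdist_nonneg)
            then show ?thesis using N by (simp add: g_def)
          qed
          then have "\<forall>\<^sub>F n in sequentially. g n z = 0"
            using eventually_sequentially by blast
          then show ?thesis
            using False by (simp add: tendsto_eventually)
        qed
      qed
      then show ?thesis
        by (rule lim_in[rotated]) (rule cont[OF g])
    qed
  next
    fix A :: "complex set" assume A: "A \<in> sigma_sets UNIV (Collect closed)" and "L2_class (?ind A) \<in> S"
    have "L2_class (?ind (UNIV - A)) = L2_class (\<lambda>z. 1 + (-1) * ?ind A z)"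
      using A by (intro arg_cong[where f = L2_class]) (auto simp: indicator_def)
    also have "\<dots> = L2_class (\<lambda>z. 1) + scaleC (-1) (L2_class (?ind A))"
      using A sq[of A] unfolding sigma[symmetric]
      by (simp only: L2_class_add[OF one square_integrable_mult] L2_class_scaleC)
    also have "\<dots> \<in> S"
      by (intro add scale cont \<open>L2_class (?ind A) \<in> S\<close>) simp
    finally show "L2_class (?ind (UNIV - A)) \<in> S" .
  next
    fix A :: "nat \<Rightarrow> complex set"
    assume disj: "disjoint_family A" and A: "range A \<subseteq> sigma_sets UNIV (Collect closed)"
      and IH: "\<And>i. L2_class (?ind (A i)) \<in> S"
    have A': "A i \<in> sets borel" for i
      using A unfolding sigma by auto
    have "(\<lambda>n. L2_class (?ind (\<Union>i<n. A i))) \<longlonglongrightarrow> L2_class (?ind (\<Union>i. A i))"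
    proof (rule L2_class_dominated_convergence[OF _ _ one])
      show "?ind (\<Union>i<n. A i) \<in> borel_measurable circle_measure" for n
        using A' by (intro meas sets.finite_UN) auto
      show "square_integrable (?ind (\<Union>i. A i))"
        using A' by (intro sq sets.countable_UN) auto
      show "norm (?ind (\<Union>i<n. A i) z) \<le> norm (1::complex)" for n z
        by (simp add: indicator_def)
      show "(\<lambda>n. ?ind (\<Union>i<n. A i) z) \<longlonglongrightarrow> ?ind (\<Union>i. A i) z" for z
        by (rule LIMSEQ_indicator_UN)
    qed
    moreover have "L2_class (?ind (\<Union>i<n. A i)) \<in> S" for n
    proof -
      have "?ind (\<Union>i<n. A i) = (\<lambda>z. \<Sum>i<n. ?ind (A i) z)"
        using disj by (intro ext indicator_UN_disjoint) (auto simp: disjoint_family_on_def)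
      then have "L2_class (?ind (\<Union>i<n. A i)) = (\<Sum>i<n. L2_class (?ind (A i)))"
        by (simp add: L2_class_sum sq A')
      also have "\<dots> \<in> S"
        by (rule sum) (simp_all add: IH)
      finally show ?thesis .
    qed
    ultimately show "L2_class (?ind (\<Union>i. A i)) \<in> S"
      by (rule lim_in[rotated])
  qed (simp_all add: zero L2_class_zero)

  have ind': "square_integrable (?ind B) \<and> L2_class (?ind B) \<in> S" if "B \<in> sets circle_measure" for B
  proof -
    have "B \<in> sets borel"
      using that by (simp add: sets_circle_measure sets_restrict_space_iff)
    then show ?thesis using ind sq by simp
  qed
  have f: "square_integrable (rep_L2 x)"
    by (rule rep_L2_square_integrable)
  obtain s where s: "\<And>i. simple_function circle_measure (s i)"
    and s_lim: "\<And>z. z \<in> space circle_measure \<Longrightarrow> (\<lambda>i. s i z) \<longlonglongrightarrow> rep_L2 x z"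
    and s_le: "\<And>i z. z \<in> space circle_measure \<Longrightarrow> dist (s i z) 0 \<le> 2 * dist (rep_L2 x z) 0"
    using borel_measurable_implies_sequence_metric[OF square_integrable_measurable[OF f], of 0]
    by metis
  have "(\<lambda>i. L2_class (s i)) \<longlonglongrightarrow> L2_class (rep_L2 x)"
    by (rule L2_class_dominated_convergence[OF _ f square_integrable_mult[OF f, of 2]])
      (use s s_lim s_le in \<open>auto simp: norm_mult borel_measurable_simple_function\<close>)
  moreover have "L2_class (s i) \<in> S" for i
  proof -
    let ?V = "s i ` sphere 0 1" and ?B = "\<lambda>v. s i -` {v} \<inter> sphere 0 1"
    have V: "finite ?V" and B: "\<And>v. v \<in> ?V \<Longrightarrow> ?B v \<in> sets circle_measure"
      using s[of i] by (auto simp: simple_function_def)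
    have eq: "(\<Sum>v\<in>?V. v * ?ind (?B v) z) = s i z" if "norm z = 1" for z
    proof -
      have "(\<Sum>v\<in>?V. v * ?ind (?B v) z) = (\<Sum>v\<in>{s i z}. v * ?ind (?B v) z)"
        using that V by (intro sum.mono_neutral_right) (auto simp: indicator_def)
      then show ?thesis using that by (simp add: indicator_def)
    qed
    have step: "square_integrable (\<lambda>z. v * ?ind (?B v) z)" if "v \<in> ?V" for v
      using ind'[OF B[OF that]] by (simp add: square_integrable_mult)
    have "square_integrable (s i)"
    proof (rule square_integrable_bounded[OF borel_measurable_simple_function[OF s]])
      show "norm (s i z) \<le> Max (norm ` ?V)" if "norm z = 1" for z
        using that V by (intro Max_ge) auto
    qed
    then have "L2_class (s i) = L2_class (\<lambda>z. \<Sum>v\<in>?V. v * ?ind (?B v) z)"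
      using eq by (intro L2_class_cong square_integrable_sum V step) auto
    also have "\<dots> = (\<Sum>v\<in>?V. scaleC v (L2_class (?ind (?B v))))"
      using ind' B by (simp add: L2_class_sum[OF V step] L2_class_scaleC)
    also have "\<dots> \<in> S"
      by (rule sum[OF V]) (intro scale conjunct2[OF ind'[OF B]])
    finally show ?thesis .
  qed
  ultimately have "L2_class (rep_L2 x) \<in> S"
    by (rule lim_in[rotated])
  then show ?thesis by simp
qed


section \<open>Trigonometric polynomials are dense\<close>

lemma trig_poly_cong: "trig_poly f \<Longrightarrow> (\<And>z. norm z = 1 \<Longrightarrow> g z = f z) \<Longrightarrow> trig_poly g"
  unfolding trig_poly_def by metis

lemma finite_int_subset_symmetric_interval:
  assumes "finite F"
  shows "\<exists>N. F \<subseteq> {- int N..int N}"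
proof -
  define N where "N = nat (Max (insert 0 (abs ` F)))"
  have "- int N \<le> n \<and> n \<le> int N" if "n \<in> F" for n
  proof -
    have "\<bar>n\<bar> \<le> Max (insert 0 (abs ` F))"
      using that assms by (intro Max_ge) auto
    then show ?thesis unfolding N_def by linarith
  qed
  then have "F \<subseteq> {- int N..int N}"
    by auto
  then show ?thesis ..
qed

lemma trig_poly_sum_powi:
  assumes "finite F"
  shows "trig_poly (\<lambda>z. \<Sum>n\<in>F. a n * z powi n)"
proof -
  obtain N where "F \<subseteq> {- int N..int N}"
    using finite_int_subset_symmetric_interval[OF assms] ..
  then have "(\<Sum>n\<in>F. a n * z powi n) = (\<Sum>n = - int N..int N. (if n \<in> F then a n else 0) * z powi n)" for z
    by (intro sum.mono_neutral_cong_left) auto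
  then show ?thesis
    unfolding trig_poly_def by (intro exI[of _ N] exI[of _ "\<lambda>n. if n \<in> F then a n else 0"]) simp
qed

lemma trig_poly_monomial: "trig_poly (\<lambda>z. a * z powi n)"
  using trig_poly_sum_powi[of "{n}" "\<lambda>_. a"] by simp

lemma trig_poly_add:
  assumes "trig_poly f" "trig_poly g"
  shows "trig_poly (\<lambda>z. f z + g z)"
proof -
  obtain M a where f: "\<And>z. norm z = 1 \<Longrightarrow> f z = (\<Sum>n = - int M..int M. a n * z powi n)"
    using assms(1) unfolding trig_poly_def by auto
  obtain N b where g: "\<And>z. norm z = 1 \<Longrightarrow> g z = (\<Sum>n = - int N..int N. b n * z powi n)"
    using assms(2) unfolding trig_poly_def by auto
  define F where "F = {- int M..int M} \<union> {- int N..int N}"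
  define A where "A n = (if n \<in> {- int M..int M} then a n else 0)" for n
  define B where "B n = (if n \<in> {- int N..int N} then b n else 0)" for n
  show ?thesis
  proof (rule trig_poly_cong[OF trig_poly_sum_powi[of F "\<lambda>n. A n + B n"]])
    show "finite F" by (simp add: F_def)
    fix z :: complex assume z: "norm z = 1"
    have "(\<Sum>n = - int M..int M. a n * z powi n) = (\<Sum>n\<in>F. A n * z powi n)"
      by (intro sum.mono_neutral_cong_left) (auto simp: F_def A_def)
    moreover have "(\<Sum>n = - int N..int N. b n * z powi n) = (\<Sum>n\<in>F. B n * z powi n)"
      by (intro sum.mono_neutral_cong_left) (auto simp: F_def B_def)
    ultimately show "f z + g z = (\<Sum>n\<in>F. (A n + B n) * z powi n)"
      by (simp add: f[OF z] g[OF z] distrib_right sum.distrib)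
  qed
qed

lemma trig_poly_sum:
  assumes "finite F" "\<And>i. i \<in> F \<Longrightarrow> trig_poly (f i)"
  shows "trig_poly (\<lambda>z. \<Sum>i\<in>F. f i z)"
  using assms
proof (induction F rule: finite_induct)
  case empty
  show ?case using trig_poly_monomial[of 0 0] by simp
qed (simp add: trig_poly_add)

lemma trig_poly_mult:
  assumes "trig_poly f" "trig_poly g"
  shows "trig_poly (\<lambda>z. f z * g z)"
proof -
  obtain M a where f: "\<And>z. norm z = 1 \<Longrightarrow> f z = (\<Sum>m = - int M..int M. a m * z powi m)"
    using assms(1) unfolding trig_poly_def by auto
  obtain N b where g: "\<And>z. norm z = 1 \<Longrightarrow> g z = (\<Sum>n = - int N..int N. b n * z powi n)"
    using assms(2) unfolding trig_poly_def by auto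
  have "trig_poly (\<lambda>z. \<Sum>m = - int M..int M. \<Sum>n = - int N..int N. (a m * b n) * z powi (m + n))"
    by (intro trig_poly_sum trig_poly_monomial) auto
  then show ?thesis
  proof (rule trig_poly_cong)
    fix z :: complex assume z: "norm z = 1"
    then have "z powi (m + n) = z powi m * z powi n" for m n
      by (subst power_int_add) auto
    then show "f z * g z
        = (\<Sum>m = - int M..int M. \<Sum>n = - int N..int N. (a m * b n) * z powi (m + n))"
      unfolding f[OF z] g[OF z] sum_product by (intro sum.cong refl) (simp add: mult_ac)
  qed
qed

lemma trig_poly_const: "trig_poly (\<lambda>z. a)"
  using trig_poly_monomial[of a 0] by simp

text \<open>
  On the circle \<open>Re z = (z + 1/z) / 2\<close> and \<open>Im z = (z - 1/z) / (2\<i>)\<close>, so real polynomials in the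
  two real coordinates are trigonometric polynomials.
\<close>

lemma trig_poly_real_polynomial:
  fixes p :: "complex \<Rightarrow> real"
  assumes "real_polynomial_function p"
  shows "trig_poly (\<lambda>z. complex_of_real (p z))"
  using assms
proof (induction p)
  case (linear p)
  define u v where "u = complex_of_real (p 1)" and "v = complex_of_real (p \<i>)"
  have "trig_poly (\<lambda>z. (u / 2 + v / (2 * \<i>)) * z powi 1 + (u / 2 - v / (2 * \<i>)) * z powi (-1))"
    by (intro trig_poly_add trig_poly_monomial)
  then show ?case
  proof (rule trig_poly_cong)
    fix z :: complex assume z: "norm z = 1"
    have inv: "inverse z = cnj z"
      using z by (simp add: inverse_complex_def complex_eq_iff cmod_power2[symmetric])
    have "p z = p (Re z *\<^sub>R 1 + Im z *\<^sub>R \<i>)"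
      using complex_eq[of z] by (simp add: scaleR_conv_of_real mult.commute)
    also have "\<dots> = Re z * p 1 + Im z * p \<i>"
      using linear by (simp add: linear_simps)
    finally have "complex_of_real (p z) = complex_of_real (Re z) * u + complex_of_real (Im z) * v"
      by (simp add: u_def v_def)
    also have "complex_of_real (Re z) = (z + cnj z) / 2"
      by (simp add: complex_add_cnj)
    also have "complex_of_real (Im z) = (z - cnj z) / (2 * \<i>)"
      by (simp add: complex_diff_cnj mult_ac)
    finally show "complex_of_real (p z)
        = (u / 2 + v / (2 * \<i>)) * z powi 1 + (u / 2 - v / (2 * \<i>)) * z powi (-1)"
      by (simp add: power_int_minus inv algebra_simps diff_divide_distrib add_divide_distrib)
  qed
qed (auto simp: trig_poly_const trig_poly_add trig_poly_mult)

lemma trig_poly_polynomial: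
  assumes "polynomial_function (g :: complex \<Rightarrow> complex)"
  shows "trig_poly g"
proof -
  have "trig_poly (\<lambda>z. complex_of_real ((Re \<circ> g) z) + \<i> * complex_of_real ((Im \<circ> g) z))"
    using assms bounded_linear_Re bounded_linear_Im unfolding polynomial_function_def
    by (intro trig_poly_add trig_poly_mult trig_poly_const trig_poly_real_polynomial) blast+
  then show ?thesis
    by (simp add: complex_eq[symmetric])
qed

lemma trig_poly_dense: "closure {L2_class f | f. trig_poly f} = UNIV" (is "closure ?V = _")
proof -
  have "x \<in> closure ?V" for x
  proof (rule closed_subspace_containing_continuous[OF closed_closure])
    fix x y assume "x \<in> closure ?V" "y \<in> closure ?V"
    then obtain u v where u: "\<And>n. u n \<in> ?V" "u \<longlonglongrightarrow> x" and v: "\<And>n. v n \<in> ?V" "v \<longlonglongrightarrow> y"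
      unfolding closure_sequential by auto
    have "u n + v n \<in> ?V" for n
      using u(1)[of n] v(1)[of n]
      by (auto simp: L2_class_add[symmetric] trig_poly_square_integrable intro: trig_poly_add)
    then show "x + y \<in> closure ?V"
      unfolding closure_sequential using tendsto_add[OF u(2) v(2)] by (intro exI[of _ "\<lambda>n. u n + v n"]) auto
  next
    fix a x assume "x \<in> closure ?V"
    then obtain u where u: "\<And>n. u n \<in> ?V" "u \<longlonglongrightarrow> x"
      unfolding closure_sequential by auto
    have "scaleC a (u n) \<in> ?V" for n
      using u(1)[of n]
      by (auto simp: L2_class_scaleC[symmetric] trig_poly_square_integrable
          intro: trig_poly_mult[OF trig_poly_const])
    then show "scaleC a x \<in> closure ?V"
      unfolding closure_sequential using bounded_linear.tendsto[OF bounded_linear_scaleC u(2)]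
      by (intro exI[of _ "\<lambda>n. scaleC a (u n)"]) auto
  next
    fix f :: "complex \<Rightarrow> complex" assume f: "continuous_on (sphere 0 1) f"
    show "L2_class f \<in> closure ?V"
      unfolding closure_approachable
    proof (intro allI impI)
      fix \<epsilon> :: real assume "0 < \<epsilon>"
      then obtain g where g: "polynomial_function g" "\<And>z. z \<in> sphere 0 1 \<Longrightarrow> norm (f z - g z) < \<epsilon>/2"
        using Stone_Weierstrass_polynomial_function[OF _ f, of "\<epsilon>/2"] by auto
      have sf: "square_integrable f" and sg: "square_integrable g"
        using continuous_square_integrable[OF f] trig_poly_square_integrable[OF trig_poly_polynomial[OF g(1)]]
        by auto
      have "norm (L2_class (\<lambda>z. f z - g z)) \<le> \<epsilon>/2"
        using g(2) by (intro norm_L2_class_le square_integrable_diff sf sg) (auto intro: less_imp_le)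
      then have "dist (L2_class g) (L2_class f) < \<epsilon>"
        using \<open>0 < \<epsilon>\<close> by (simp add: dist_norm norm_minus_commute[of "L2_class g"] L2_class_diff[OF sf sg])
      then show "\<exists>y\<in>?V. dist y (L2_class f) < \<epsilon>"
        using trig_poly_polynomial[OF g(1)] by blast
    qed
  qed
  then show ?thesis by blast
qed


section \<open>The Fourier basis of the circle\<close>

definition fourier_basis :: "int \<Rightarrow> L2_circle" where
  "fourier_basis n = L2_class (\<lambda>z. z powi n)"

lemma square_integrable_powi: "square_integrable (\<lambda>z. a * z powi n)"
  by (rule trig_poly_square_integrable[OF trig_poly_monomial])

lemma L2_class_sum_powi:
  "finite F \<Longrightarrow> L2_class (\<lambda>z. \<Sum>n\<in>F. a n * z powi n) = (\<Sum>n\<in>F. scaleC (a n) (fourier_basis n))"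
  using square_integrable_powi[of 1]
  by (simp add: L2_class_sum square_integrable_powi L2_class_scaleC fourier_basis_def)

text \<open>For \<open>k \<noteq> 0\<close> the antiderivative \<open>e\<^sup>i\<^sup>k\<^sup>t / (\<i> k)\<close> takes the same value at \<open>0\<close> and \<open>2\<pi>\<close>.\<close>

lemma integral_powi_circle: "(\<integral>z. z powi k \<partial>circle_measure) = (if k = 0 then 1 else 0)"
proof (cases "k = 0")
  case True
  then show ?thesis
    using emeasure_circle_space by (simp add: measure_def)
next
  case False
  have density: "uniform_measure lborel {0..<2 * pi}
      = density lborel (\<lambda>t. ennreal (indicator {0..<2 * pi} t / (2 * pi)))"
    unfolding uniform_measure_def
    by (intro arg_cong[where f = "density lborel"] ext)
      (auto simp: indicator_def divide_ennreal[symmetric])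
  have cont: "continuous_on UNIV (\<lambda>t. cis t powi k)"
    by (intro continuous_intros) auto
  have "(\<lambda>z. z powi k) \<in> borel_measurable circle_measure"
    using square_integrable_measurable[OF square_integrable_powi[of 1 k]] by simp
  then have "(\<integral>z. z powi k \<partial>circle_measure) = (\<integral>t. cis t powi k \<partial>uniform_measure lborel {0..<2 * pi})"
    unfolding circle_measure_def
    by (subst integral_distr[OF cis_measurable_circle])
      (simp_all add: measurable_cong_sets[OF sets_circle_measure refl, unfolded circle_measure_def])
  also have "\<dots> = (\<integral>t. (indicator {0..<2 * pi} t / (2 * pi)) *\<^sub>R cis t powi k \<partial>lborel)"
    unfolding density by (rule integral_density)
      (use cont in \<open>auto intro!: borel_measurable_continuous_onI\<close>)
  also have "\<dots> = (\<integral>t. (1 / (2 * pi)) *\<^sub>R (indicator {0..2 * pi} t *\<^sub>R cis t powi k) \<partial>lborel)"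
  proof (rule integral_cong_AE)
    show "AE t in lborel. (indicator {0..<2 * pi} t / (2 * pi)) *\<^sub>R cis t powi k
        = (1 / (2 * pi)) *\<^sub>R (indicator {0..2 * pi} t *\<^sub>R cis t powi k)"
      using AE_lborel_singleton[of "2 * pi"] by eventually_elim (auto simp: indicator_def)
  qed (use borel_measurable_continuous_onI[OF cont] in measurable)
  also have "\<dots> = (1 / (2 * pi)) *\<^sub>R (\<integral>t. indicator {0..2 * pi} t *\<^sub>R cis t powi k \<partial>lborel)"
    by (rule integral_scaleR_right)
  also have "(\<integral>t. indicator {0..2 * pi} t *\<^sub>R cis t powi k \<partial>lborel)
      = exp (\<i> * of_int k * of_real (2 * pi)) / (\<i> * of_int k) - exp (\<i> * of_int k * of_real 0) / (\<i> * of_int k)"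
  proof (rule integral_FTC_atLeastAtMost)
    fix t :: real
    have cis: "cis t powi k = exp (\<i> * of_int k * of_real t)"
      by (simp add: cis_power_int) (simp add: cis_conv_exp mult_ac)
    have "((\<lambda>t. exp (\<i> * of_int k * t) / (\<i> * of_int k)) has_field_derivative
        exp (\<i> * of_int k * of_real t)) (at (of_real t))"
      using False by (auto intro!: derivative_eq_intros)
    then show "((\<lambda>t. exp (\<i> * of_int k * of_real t) / (\<i> * of_int k)) has_vector_derivative cis t powi k)
        (at t within {0..2 * pi})"
      unfolding cis by (rule has_vector_derivative_real_field)
  qed (use cont in \<open>auto intro: continuous_on_subset\<close>)
  also have "exp (\<i> * of_int k * of_real (2 * pi)) = 1"
    using exp_integer_2pi[of "of_int k"] by (simp add: mult_ac)
  finally show ?thesis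
    using False by simp
qed

lemma orthonormal_fourier_basis:
  "cinner (fourier_basis m) (fourier_basis n) = (if m = n then 1 else 0)"
proof -
  have "cinner (fourier_basis m) (fourier_basis n) = (\<integral>z. z powi m * cnj (z powi n) \<partial>circle_measure)"
    unfolding fourier_basis_def
    using square_integrable_powi[of 1] by (intro cinner_L2_class) auto
  also have "\<dots> = (\<integral>z. z powi (m - n) \<partial>circle_measure)"
  proof (rule Bochner_Integration.integral_cong)
    fix z assume "z \<in> space circle_measure"
    then have z: "norm z = 1" by simp
    then have "cnj (z powi n) = inverse (z powi n)"
      using complex_norm_square[of "z powi n"]
      by (intro inverse_unique[symmetric]) (simp add: norm_power_int mult.commute)
    moreover have "z powi (m - n) = z powi m * inverse (z powi n)"
      using z by (subst power_int_diff) (auto simp: divide_inverse)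
    ultimately show "z powi m * cnj (z powi n) = z powi (m - n)" by simp
  qed simp
  finally show ?thesis
    by (simp add: integral_powi_circle)
qed

interpretation circle: orthonormal_basis fourier_basis
proof
  show "cinner (fourier_basis m) (fourier_basis n) = (if m = n then 1 else 0)" for m n
    by (rule orthonormal_fourier_basis)
  fix \<epsilon> :: real and x assume "0 < \<epsilon>"
  moreover have "x \<in> closure {L2_class f | f. trig_poly f}"
    by (simp add: trig_poly_dense)
  ultimately obtain f where f: "trig_poly f" and near: "dist (L2_class f) x < \<epsilon>"
    unfolding closure_approachable by blast
  obtain N a where eq: "\<And>z. norm z = 1 \<Longrightarrow> f z = (\<Sum>n = - int N..int N. a n * z powi n)"
    using f unfolding trig_poly_def by auto
  have "L2_class f = L2_class (\<lambda>z. \<Sum>n = - int N..int N. a n * z powi n)"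
    by (intro L2_class_cong trig_poly_square_integrable f trig_poly_sum_powi eq) auto
  then have "norm (x - (\<Sum>n = - int N..int N. scaleC (a n) (fourier_basis n))) < \<epsilon>"
    using near by (simp add: L2_class_sum_powi dist_norm norm_minus_commute)
  then show "\<exists>F a. finite F \<and> norm (x - (\<Sum>n\<in>F. scaleC (a n) (fourier_basis n))) < \<epsilon>"
    by blast
qed


section \<open>The first-order operators\<close>

lemma first_order_op_sum_powi:
  assumes F: "finite F" and f: "\<And>z. norm z = 1 \<Longrightarrow> f z = (\<Sum>n\<in>F. a n * z powi n)"
    and z: "norm z = 1"
  shows "first_order_op b c f z = (\<Sum>n\<in>F. ((b * of_int n + c) * a n) * z powi n)"
proof -
  obtain N where N: "F \<subseteq> {- int N..int N}"
    using finite_int_subset_symmetric_interval[OF F] ..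
  define a' where "a' n = (if n \<in> F then a n else 0)" for n
  have f': "f z = (\<Sum>n = - int N..int N. a' n * z powi n)" if "norm z = 1" for z
    unfolding f[OF that] using N by (intro sum.mono_neutral_cong_left) (auto simp: a'_def)
  have "angular_deriv f z = (\<Sum>n = - int N..int N. \<i> * of_int n * a' n * z powi n)"
    using f' z by (rule angular_deriv_trig_poly)
  also have "\<dots> = (\<Sum>n\<in>F. \<i> * of_int n * a n * z powi n)"
    using N by (intro sum.mono_neutral_cong_right) (auto simp: a'_def)
  finally have "angular_deriv f z = (\<Sum>n\<in>F. \<i> * of_int n * a n * z powi n)" .
  then show ?thesis
    unfolding first_order_op_def f[OF z]
    by (simp add: sum_distrib_left sum.distrib[symmetric] algebra_simps)
qed

text \<open>
  The graph over the trigonometric polynomials is the graph of a weighted shift over the span of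
  the basis.
\<close>

lemma closure_trig_poly_graph:
  assumes s: "bij s"
    and T: "\<And>f F a. finite F \<Longrightarrow> trig_poly f \<Longrightarrow> (\<And>z. norm z = 1 \<Longrightarrow> f z = (\<Sum>n\<in>F. a n * z powi n)) \<Longrightarrow>
      L2_class (T f) = (\<Sum>n\<in>F. scaleC (w n * a n) (fourier_basis (s n)))"
  shows "closure {(L2_class f, L2_class (T f)) | f. trig_poly f} = circle.weighted_shift s w"
proof -
  have "{(L2_class f, L2_class (T f)) | f. trig_poly f} =
      {(\<Sum>n\<in>F. scaleC (a n) (fourier_basis n), \<Sum>n\<in>F. scaleC (w n * a n) (fourier_basis (s n))) | F a.
        finite F}" (is "?L = ?R")
  proof (intro equalityI subsetI)
    fix p assume "p \<in> ?L"
    then obtain f where p: "p = (L2_class f, L2_class (T f))" and f: "trig_poly f" by blast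
    obtain N a where eq: "\<And>z. norm z = 1 \<Longrightarrow> f z = (\<Sum>n = - int N..int N. a n * z powi n)"
      using f unfolding trig_poly_def by auto
    have "L2_class f = L2_class (\<lambda>z. \<Sum>n = - int N..int N. a n * z powi n)"
      by (intro L2_class_cong trig_poly_square_integrable f trig_poly_sum_powi eq) auto
    then have "p = (\<Sum>n = - int N..int N. scaleC (a n) (fourier_basis n),
        \<Sum>n = - int N..int N. scaleC (w n * a n) (fourier_basis (s n)))"
      unfolding p using T[OF _ f eq] by (simp add: L2_class_sum_powi)
    then show "p \<in> ?R" by blast
  next
    fix p assume "p \<in> ?R"
    then obtain F a where F: "finite F" and p: "p = (\<Sum>n\<in>F. scaleC (a n) (fourier_basis n),
        \<Sum>n\<in>F. scaleC (w n * a n) (fourier_basis (s n)))" by blast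
    let ?f = "\<lambda>z. \<Sum>n\<in>F. a n * z powi n"
    have f: "trig_poly ?f" by (rule trig_poly_sum_powi[OF F])
    have "p = (L2_class ?f, L2_class (T ?f))"
      unfolding p using T[OF F f refl] by (simp add: L2_class_sum_powi[OF F])
    then show "p \<in> ?L" using f by blast
  qed
  then show ?thesis
    by (simp only: circle.closure_graph_on_span[OF s])
qed

lemma D_tau_inf_eq_weighted_shift:
  "D_tau_inf \<beta> c = circle.weighted_shift id (\<lambda>n. increment_limit \<beta> * of_int n + c)"
  unfolding D_tau_inf_def
proof (rule closure_trig_poly_graph[OF bij_id])
  let ?w = "\<lambda>n. increment_limit \<beta> * of_int n + c"
  fix f F a
  assume F: "finite F" and f: "trig_poly f" and eq: "\<And>z. norm z = 1 \<Longrightarrow> f z = (\<Sum>n\<in>F. a n * z powi n)"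
  have "L2_class (first_order_op (increment_limit \<beta>) c f) = L2_class (\<lambda>z. \<Sum>n\<in>F. (?w n * a n) * z powi n)"
    by (intro L2_class_cong trig_poly_square_integrable trig_poly_first_order_op f trig_poly_sum_powi F
        first_order_op_sum_powi eq)
  then show "L2_class (first_order_op (increment_limit \<beta>) c f) =
      (\<Sum>n\<in>F. scaleC (?w n * a n) (fourier_basis (id n)))"
    by (simp add: L2_class_sum_powi[OF F])
qed

lemma bij_succ_int: "bij (\<lambda>n::int. n + 1)"
  by (rule bij_betw_byWitness[where f' = "\<lambda>n. n - 1"]) auto

lemma D_tilde_tau_inf_eq_weighted_shift:
  "D_tilde_tau_inf \<beta> c = circle.weighted_shift (\<lambda>n. n + 1) (\<lambda>n. increment_limit \<beta> * of_int n + c)"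
  unfolding D_tilde_tau_inf_def
proof (rule closure_trig_poly_graph[OF bij_succ_int])
  let ?w = "\<lambda>n. increment_limit \<beta> * of_int n + c"
  fix f F a
  assume F: "finite F" and f: "trig_poly f" and eq: "\<And>z. norm z = 1 \<Longrightarrow> f z = (\<Sum>n\<in>F. a n * z powi n)"
  have "L2_class (\<lambda>z. z * first_order_op (increment_limit \<beta>) c f z)
      = L2_class (\<lambda>z. \<Sum>n\<in>F. (?w n * a n) * z powi (n + 1))"
  proof (intro L2_class_cong trig_poly_square_integrable trig_poly_first_order_op f trig_poly_sum F
      trig_poly_monomial)
    fix z :: complex assume z: "norm z = 1"
    then have "z powi (n + 1) = z * z powi n" for n
      by (subst power_int_add) auto
    then show "z * first_order_op (increment_limit \<beta>) c f z = (\<Sum>n\<in>F. (?w n * a n) * z powi (n + 1))"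
      by (simp add: first_order_op_sum_powi[OF F eq z] sum_distrib_left mult_ac)
  qed
  also have "\<dots> = (\<Sum>n\<in>F. scaleC (?w n * a n) (fourier_basis (n + 1)))"
    using square_integrable_powi[of 1]
    by (simp add: L2_class_sum[OF F] square_integrable_powi L2_class_scaleC fourier_basis_def)
  finally show "L2_class (\<lambda>z. z * first_order_op (increment_limit \<beta>) c f z) =
      (\<Sum>n\<in>F. scaleC (?w n * a n) (fourier_basis (n + 1)))" .
qed

lemma finite_bounded_affine_iff:
  "(\<forall>R. finite {n::int. norm (b * of_int n + c) \<le> R}) \<longleftrightarrow> (b::complex) \<noteq> 0"
proof
  assume fin: "\<forall>R. finite {n::int. norm (b * of_int n + c) \<le> R}"
  show "b \<noteq> 0"
  proof
    assume "b = 0"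
    then have "{n::int. norm (b * of_int n + c) \<le> norm c} = UNIV" by auto
    then show False using fin infinite_UNIV_int by metis
  qed
next
  assume b: "b \<noteq> 0"
  show "\<forall>R. finite {n::int. norm (b * of_int n + c) \<le> R}"
  proof
    fix R
    define M where "M = \<lceil>(R + norm c) / norm b\<rceil>"
    have "n \<in> {- M..M}" if "norm (b * of_int n + c) \<le> R" for n :: int
    proof -
      have "norm (b * of_int n) \<le> norm (b * of_int n + c) + norm c"
        using norm_triangle_ineq4[of "b * of_int n + c" c] by simp
      then have "norm b * \<bar>of_int n\<bar> \<le> R + norm c"
        using that by (simp add: norm_mult)
      then have "\<bar>of_int n\<bar> \<le> (R + norm c) / norm b"
        using b by (simp add: pos_le_divide_eq mult.commute)
      then have "\<bar>n\<bar> \<le> M"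
        unfolding M_def by linarith
      then show ?thesis by auto
    qed
    then show "finite {n::int. norm (b * of_int n + c) \<le> R}"
      by (intro finite_subset[OF subsetI finite_atLeastAtMost_int]) simp
  qed
qed

theorem proposition7p2:
  fixes \<beta> :: "nat \<Rightarrow> complex" and c :: complex
  assumes "\<beta> \<in> c_inc"
  shows "(has_compact_parametrices (D_tau_inf \<beta> c) \<longleftrightarrow> increment_limit \<beta> \<noteq> 0) \<and>
         (has_compact_parametrices (D_tilde_tau_inf \<beta> c) \<longleftrightarrow> increment_limit \<beta> \<noteq> 0)"
  unfolding D_tau_inf_eq_weighted_shift D_tilde_tau_inf_eq_weighted_shift
    circle.compact_parametrices_weighted_shift_iff[OF bij_id]
    circle.compact_parametrices_weighted_shift_iff[OF bij_succ_int] finite_bounded_affine_iff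
  by simp

end
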